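(* Let $\epsilon\in\{-1,1\}$ and let $(M^{2n},\mathcal J^\epsilon,g)$ be a totally $\epsilon$-complex submanifold of a non-flat para-quaternionic space form $\widetilde M^{4n}$ with reduced scalar curvature $\nu$. Then, for $X,Y\in TM$: (1) $R^{TT}_{XY}=-\epsilon\nu(R^\epsilon_{\mathbb CP^n})_{XY}=\epsilon\frac{\nu}{4}\Big(\epsilon X\wedge Y-J_1X\wedge J_1Y+2\langle J_1X,Y\rangle J_1\Big)$. (2) $\mathrm{Ric}(R^{TT})=\frac{\nu}{2}(n+1)g$, where $g=\widetilde g|_M$. (3) $R^{\perp T}=R^{T\perp}=0$. (4) $R^{\perp\perp}_{XY}=\frac{\nu}{4}\Big(-J_2X\wedge J_2Y+\epsilon J_3X\wedge J_3Y+2\epsilon\langle J_1X,Y\rangle J_1\Big)$.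
   Context: An almost para-quaternionic structure on $\widetilde M$ is a rank 3 subbundle $Q\subset \mathrm{End}\,T\widetilde M$ locally generated by three anticommuting fields of endomorphisms $J_1,J_2,J_3=J_1J_2$ with $J_\alpha^2=\epsilon_\alpha Id$, where $(\epsilon_1,\epsilon_2,\epsilon_3)$ is a permutation of $(-1,1,1)$. A para-quaternionic Kähler manifold $(\widetilde M^{4n},Q,\widetilde g)$ is a pseudo-Riemannian manifold (of dimension $4n$, neutral signature) with such a $Q$ consisting of $\widetilde g$-skew-symmetric endomorphisms and preserved by the Levi-Civita connection. $\nu=scal/(4n(n+2))$ is the reduced scalar curvature. A non-flat para-quaternionic space form is such a manifold locally isometric to the para-quaternionic projective space or its dual para-quaternionic hyperbolic space with standard metric of reduced scalar curvature $\nu\neq0$; its curvature tensor is $\widetilde R=\nu R_0$ with $R_0(X,Y)=\frac12\sum_\alpha\epsilon_\alpha\widetilde g(J_\alpha X,Y)J_\alpha+\frac14\big(X\wedge Y-\sum_\alpha\epsilon_\alpha J_\alpha X\wedge J_\alpha Y\big)$, where $(X\wedge Y)Z=\langle Y,Z\rangle X-\langle X,Z\rangle Y$, $\langle\cdot,\cdot\rangle=\widetilde g$. A $\widetilde g$-non-degenerate submanifold $M\subset\widetilde M$ is an almost $\epsilon$-Hermitian submanifold if there is a section $J^\epsilon:M\to Q|_M$ with $J^\epsilon TM=TM$ and $(J^\epsilon)^2=\epsilon Id$; put $g=\widetilde g|_M$, $\mathcal J^\epsilon=J^\epsilon|_{TM}$. An adapted basis is a local frame $(J_1,J_2,J_3)$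 of $Q$ with $J_1|_M=J^\epsilon$, $J_1^2=\epsilon Id$, $J_2^2=Id$, $J_3=J_1J_2=-J_2J_1$ (so $(\epsilon_1,\epsilon_2,\epsilon_3)=(\epsilon,1,-\epsilon)$). $M$ is totally $\epsilon$-complex if $J_2T_xM\perp T_xM$ for all $x\in M$; here $\dim M=2n$ so $T_x\widetilde M=T_xM\oplus J_2T_xM$. For $X,Y\in TM$, $\widetilde R_{XY}=R^{TT}_{XY}+R^{\perp T}_{XY}+R^{T\perp}_{XY}+R^{\perp\perp}_{XY}$ is the decomposition according to $\mathrm{End}(T\widetilde M)=\mathrm{End}(TM)+\mathrm{Hom}(TM,T^\perp M)+\mathrm{Hom}(T^\perp M,TM)+\mathrm{End}(T^\perp M)$ (so in (1) and (4) the right sides are restricted to $TM$, resp. $T^\perp M$). $\mathrm{Ric}(R^{TT})(X,Y)=\mathrm{tr}(Z\mapsto R^{TT}_{ZX}Y)$. $R^\epsilon_{\mathbb CP^n}(X,Y)=\frac14\big(-\epsilon X\wedge Y+JX\wedge JY-2\langle JX,Y\rangle J\big)$ with $J=\mathcal J^\epsilon$ is the (normalized) curvature tensor of the $\epsilon$-complex projective space. *)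

theory Defs
  imports "HOL-Analysis.Analysis"
begin

section \<open>Smooth manifolds, described by their maximal atlases\<close>

primrec cont_diff :: "nat \<Rightarrow> 'a::real_normed_vector set \<Rightarrow> ('a \<Rightarrow> 'b::real_normed_vector) \<Rightarrow> bool" where
  "cont_diff 0 S f \<longleftrightarrow> continuous_on S f"
| "cont_diff (Suc k) S f \<longleftrightarrow>
     (\<forall>x\<in>S. f differentiable (at x)) \<and> (\<forall>v. cont_diff k S (\<lambda>x. frechet_derivative f (at x) v))"

text \<open>Only used for open sets \<open>S\<close> of a finite-dimensional space, where it is \<open>C\<^sup>\<infinity>\<close>.\<close>

definition smooth_on :: "'a::real_normed_vector set \<Rightarrow> ('a \<Rightarrow> 'b::real_normed_vector) \<Rightarrow> bool" where
  "smooth_on S f \<longleftrightarrow> (\<forall>k. cont_diff k S f)"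

text \<open>A chart is a pair of an open set and a coordinate map; the values of the coordinate map
  outside the open set are irrelevant.\<close>

type_synonym ('m, 'e) chart = "'m set \<times> ('m \<Rightarrow> 'e)"

definition chart_image :: "('m, 'e) chart \<Rightarrow> 'e set" where
  "chart_image c = snd c ` fst c"

definition chart_inv :: "('m, 'e) chart \<Rightarrow> 'e \<Rightarrow> 'm" where
  "chart_inv c = inv_into (fst c) (snd c)"

definition is_chart :: "('m::topological_space, 'e::euclidean_space) chart \<Rightarrow> bool" where
  "is_chart c \<longleftrightarrow> open (fst c) \<and> open (chart_image c) \<and>
     (\<exists>\<psi>. homeomorphism (fst c) (chart_image c) (snd c) \<psi>)"

definition local_rep :: "('k, 'd) chart \<Rightarrow> ('k \<Rightarrow> 'm) \<Rightarrow> ('m, 'e) chart \<Rightarrow> 'd \<Rightarrow> 'e" where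
  "local_rep b f c = (\<lambda>y. snd c (f (chart_inv b y)))"

definition transition :: "('m, 'e) chart \<Rightarrow> ('m, 'e) chart \<Rightarrow> 'e \<Rightarrow> 'e" where
  "transition c d = local_rep c id d"

text \<open>The change of components, from the chart \<open>c\<close> to the chart \<open>d\<close>, of a tangent vector
  at the point \<open>p\<close>.\<close>

definition change :: "('m, 'e::euclidean_space) chart \<Rightarrow> ('m, 'e) chart \<Rightarrow> 'm \<Rightarrow> 'e \<Rightarrow> 'e" where
  "change c d p = frechet_derivative (transition c d) (at (snd c p))"

definition compatible :: "('m, 'e::euclidean_space) chart \<Rightarrow> ('m, 'e) chart \<Rightarrow> bool" where
  "compatible c d \<longleftrightarrow> smooth_on (snd c ` (fst c \<inter> fst d)) (transition c d) \<and>
     smooth_on (snd d ` (fst c \<inter> fst d)) (transition d c)"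

definition smooth_structure ::
    "('m::{t2_space, second_countable_topology}, 'e::euclidean_space) chart set \<Rightarrow> bool" where
  "smooth_structure A \<longleftrightarrow>
     (\<Union>c\<in>A. fst c) = UNIV \<and>
     (\<forall>c\<in>A. is_chart c) \<and>
     (\<forall>c\<in>A. \<forall>d\<in>A. compatible c d) \<and>
     (\<forall>c. is_chart c \<and> (\<forall>d\<in>A. compatible c d) \<longrightarrow> c \<in> A)"

definition immersion ::
    "('k::topological_space, 'd::euclidean_space) chart set \<Rightarrow>
     ('m::topological_space, 'e::euclidean_space) chart set \<Rightarrow> ('k \<Rightarrow> 'm) \<Rightarrow> bool" where
  "immersion B A f \<longleftrightarrow> continuous_on UNIV f \<and>
     (\<forall>b\<in>B. \<forall>c\<in>A. smooth_on (snd b ` (fst b \<inter> f -` fst c)) (local_rep b f c) \<and>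
       (\<forall>p\<in>fst b \<inter> f -` fst c. inj (frechet_derivative (local_rep b f c) (at (snd b p)))))"

text \<open>The image of the tangent space at \<open>p\<close> under the differential of \<open>f\<close>, in components
  with respect to the chart \<open>c\<close> around \<open>f p\<close>.\<close>

definition tangent_space ::
    "('k::topological_space, 'd::euclidean_space) chart set \<Rightarrow> ('k \<Rightarrow> 'm) \<Rightarrow>
     ('m, 'e::euclidean_space) chart \<Rightarrow> 'k \<Rightarrow> 'e set" where
  "tangent_space B f c p =
     (\<Union>b\<in>{b\<in>B. p \<in> fst b}. range (frechet_derivative (local_rep b f c) (at (snd b p))))"


section \<open>Linear algebra of a possibly indefinite scalar product\<close>

definition scalar_product :: "('e::euclidean_space \<Rightarrow> 'e \<Rightarrow> real) \<Rightarrow> bool" where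
  "scalar_product g \<longleftrightarrow> bilinear g \<and> (\<forall>u v. g u v = g v u) \<and> (\<forall>u. (\<forall>v. g u v = 0) \<longrightarrow> u = 0)"

definition neutral :: "('e::euclidean_space \<Rightarrow> 'e \<Rightarrow> real) \<Rightarrow> bool" where
  "neutral g \<longleftrightarrow> (\<exists>P N. subspace P \<and> subspace N \<and> 2 * dim P = DIM('e) \<and> 2 * dim N = DIM('e) \<and>
     (\<forall>u\<in>P. u \<noteq> 0 \<longrightarrow> g u u > 0) \<and> (\<forall>u\<in>N. u \<noteq> 0 \<longrightarrow> g u u < 0))"

definition nondegenerate_on :: "('e::real_vector \<Rightarrow> 'e \<Rightarrow> real) \<Rightarrow> 'e set \<Rightarrow> bool" where
  "nondegenerate_on g W \<longleftrightarrow> (\<forall>u\<in>W. (\<forall>v\<in>W. g u v = 0) \<longrightarrow> u = 0)"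

definition orth_complement :: "('e::real_vector \<Rightarrow> 'e \<Rightarrow> real) \<Rightarrow> 'e set \<Rightarrow> 'e set" where
  "orth_complement g W = {v. \<forall>w\<in>W. g v w = 0}"

text \<open>The components of a vector along \<open>W\<close> and its \<open>g\<close>-orthogonal complement, meaningful if
  \<open>g\<close> is non-degenerate on \<open>W\<close>.\<close>

definition tan_part :: "('e::real_vector \<Rightarrow> 'e \<Rightarrow> real) \<Rightarrow> 'e set \<Rightarrow> 'e \<Rightarrow> 'e" where
  "tan_part g W v = (THE w. w \<in> W \<and> v - w \<in> orth_complement g W)"

definition nor_part :: "('e::real_vector \<Rightarrow> 'e \<Rightarrow> real) \<Rightarrow> 'e set \<Rightarrow> 'e \<Rightarrow> 'e" where
  "nor_part g W v = v - tan_part g W v"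

definition trace_on :: "'e::euclidean_space set \<Rightarrow> ('e \<Rightarrow> 'e) \<Rightarrow> real" where
  "trace_on W L = (let B = (SOME B. B \<subseteq> W \<and> independent B \<and> span B = W)
     in \<Sum>b\<in>B. representation B (L b) b)"

definition wedge :: "('e::real_vector \<Rightarrow> 'e \<Rightarrow> real) \<Rightarrow> 'e \<Rightarrow> 'e \<Rightarrow> 'e \<Rightarrow> 'e" where
  "wedge g X Y Z = g Y Z *\<^sub>R X - g X Z *\<^sub>R Y"

definition R_CP :: "real \<Rightarrow> ('e::real_vector \<Rightarrow> 'e \<Rightarrow> real) \<Rightarrow> ('e \<Rightarrow> 'e) \<Rightarrow> 'e \<Rightarrow> 'e \<Rightarrow> 'e \<Rightarrow> 'e" where
  "R_CP \<epsilon> g J X Y Z =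
     (1/4) *\<^sub>R (- \<epsilon> *\<^sub>R wedge g X Y Z + wedge g (J X) (J Y) Z - (2 * g (J X) Y) *\<^sub>R J Z)"

definition pq_triple :: "real \<Rightarrow> real \<Rightarrow> real \<Rightarrow> ('e::real_vector \<Rightarrow> 'e) \<Rightarrow> ('e \<Rightarrow> 'e) \<Rightarrow> ('e \<Rightarrow> 'e) \<Rightarrow> bool" where
  "pq_triple e1 e2 e3 J1 J2 J3 \<longleftrightarrow>
     (e1, e2, e3) \<in> {(-1, 1, 1), (1, -1, 1), (1, 1, -1)} \<and>
     linear J1 \<and> linear J2 \<and> linear J3 \<and>
     (\<forall>v. J1 (J1 v) = e1 *\<^sub>R v \<and> J2 (J2 v) = e2 *\<^sub>R v \<and> J3 (J3 v) = e3 *\<^sub>R v) \<and>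
     (\<forall>v. J1 (J2 v) = - J2 (J1 v) \<and> J2 (J3 v) = - J3 (J2 v) \<and> J3 (J1 v) = - J1 (J3 v)) \<and>
     (\<forall>v. J3 v = J1 (J2 v))"

definition end_span3 :: "('e::real_vector \<Rightarrow> 'e) \<Rightarrow> ('e \<Rightarrow> 'e) \<Rightarrow> ('e \<Rightarrow> 'e) \<Rightarrow> ('e \<Rightarrow> 'e) set" where
  "end_span3 J1 J2 J3 = {(\<lambda>v. a *\<^sub>R J1 v + b *\<^sub>R J2 v + c *\<^sub>R J3 v) |a b c. True}"


section \<open>Pseudo-Riemannian metrics in coordinates\<close>

text \<open>Directional derivative \<open>\<partial>\<^sub>u f\<close> at \<open>x\<close>.\<close>

abbreviation dd :: "('e::euclidean_space \<Rightarrow> 'b::real_normed_vector) \<Rightarrow> 'e \<Rightarrow> 'e \<Rightarrow> 'b" where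
  "dd f x u \<equiv> frechet_derivative f (at x) u"

text \<open>The Levi-Civita connection is \<open>\<nabla>\<^sub>u V = \<partial>\<^sub>u V + \<Gamma>(u, V)\<close>, with \<open>\<Gamma>\<close> determined by the Koszul
  formula for coordinate (that is, constant) vector fields.\<close>

definition christoffel ::
    "('e::euclidean_space \<Rightarrow> 'e \<Rightarrow> 'e \<Rightarrow> real) \<Rightarrow> 'e \<Rightarrow> 'e \<Rightarrow> 'e \<Rightarrow> 'e" where
  "christoffel g x u v = (THE w. \<forall>z. 2 * g x w z =
     dd (\<lambda>y. g y v z) x u + dd (\<lambda>y. g y u z) x v - dd (\<lambda>y. g y u v) x z)"

text \<open>Sign convention: \<open>R(X, Y) = [\<nabla>\<^sub>X, \<nabla>\<^sub>Y] - \<nabla>\<^bsub>[X, Y]\<^esub>\<close>.\<close>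

definition riemann ::
    "('e::euclidean_space \<Rightarrow> 'e \<Rightarrow> 'e \<Rightarrow> real) \<Rightarrow> 'e \<Rightarrow> 'e \<Rightarrow> 'e \<Rightarrow> 'e \<Rightarrow> 'e" where
  "riemann g x u v w =
     dd (\<lambda>y. christoffel g y v w) x u - dd (\<lambda>y. christoffel g y u w) x v
     + christoffel g x u (christoffel g x v w) - christoffel g x v (christoffel g x u w)"

definition ricci :: "('e::euclidean_space \<Rightarrow> 'e \<Rightarrow> 'e \<Rightarrow> real) \<Rightarrow> 'e \<Rightarrow> 'e \<Rightarrow> 'e \<Rightarrow> real" where
  "ricci g x u v = trace_on UNIV (\<lambda>z. riemann g x z u v)"

text \<open>The trace with respect to \<open>g\<close> of the Ricci tensor.\<close>

definition scalar_curvature :: "('e::euclidean_space \<Rightarrow> 'e \<Rightarrow> 'e \<Rightarrow> real) \<Rightarrow> 'e \<Rightarrow> real" where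
  "scalar_curvature g x =
     trace_on UNIV (\<lambda>u. THE w. \<forall>v. g x w v = ricci g x u v)"

definition reduced_scalar_curvature ::
    "nat \<Rightarrow> ('e::euclidean_space \<Rightarrow> 'e \<Rightarrow> 'e \<Rightarrow> real) \<Rightarrow> 'e \<Rightarrow> real" where
  "reduced_scalar_curvature n g x = scalar_curvature g x / (4 * real n * (real n + 2))"

definition cov_deriv_end ::
    "('e::euclidean_space \<Rightarrow> 'e \<Rightarrow> 'e \<Rightarrow> real) \<Rightarrow> ('e \<Rightarrow> 'e \<Rightarrow> 'e) \<Rightarrow> 'e \<Rightarrow> 'e \<Rightarrow> 'e \<Rightarrow> 'e" where
  "cov_deriv_end g J x u v =
     dd (\<lambda>y. J y v) x u + christoffel g x u (J x v) - J x (christoffel g x u v)"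


section \<open>Para-quaternionic Kaehler manifolds and space forms\<close>

text \<open>Tensor fields on a manifold are families, indexed by the charts \<open>c\<close>, of component functions
  on the image of \<open>c\<close>, subject to the transformation law under changes of charts.\<close>

type_synonym ('m, 'e) metric_field = "('m, 'e) chart \<Rightarrow> 'e \<Rightarrow> 'e \<Rightarrow> 'e \<Rightarrow> real"
type_synonym ('m, 'e) end_bundle = "('m, 'e) chart \<Rightarrow> 'e \<Rightarrow> ('e \<Rightarrow> 'e) set"

definition pseudo_riemannian ::
    "('m::topological_space, 'e::euclidean_space) chart set \<Rightarrow> ('m, 'e) metric_field \<Rightarrow> bool" where
  "pseudo_riemannian A G \<longleftrightarrow>
     (\<forall>c\<in>A. \<forall>x\<in>chart_image c. scalar_product (G c x)) \<and>
     (\<forall>c\<in>A. \<forall>u v. smooth_on (chart_image c) (\<lambda>x. G c x u v)) \<and>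
     (\<forall>c\<in>A. \<forall>d\<in>A. \<forall>p\<in>fst c \<inter> fst d. \<forall>u v.
        G c (snd c p) u v = G d (snd d p) (change c d p u) (change c d p v))"

definition smooth_section :: "('e::euclidean_space \<Rightarrow> ('e \<Rightarrow> 'e) set) \<Rightarrow> 'e set \<Rightarrow> ('e \<Rightarrow> 'e \<Rightarrow> 'e) \<Rightarrow> bool" where
  "smooth_section Q V J \<longleftrightarrow> (\<forall>x\<in>V. J x \<in> Q x) \<and> (\<forall>v. smooth_on V (\<lambda>x. J x v))"

definition almost_para_quaternionic ::
    "('m::topological_space, 'e::euclidean_space) chart set \<Rightarrow> ('m, 'e) end_bundle \<Rightarrow> bool" where
  "almost_para_quaternionic A Q \<longleftrightarrow>
     (\<forall>c\<in>A. \<forall>x\<in>chart_image c. \<exists>V J1 J2 J3 e1 e2 e3. open V \<and> x \<in> V \<and> V \<subseteq> chart_image c \<and>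
        smooth_section (Q c) V J1 \<and> smooth_section (Q c) V J2 \<and> smooth_section (Q c) V J3 \<and>
        (\<forall>y\<in>V. pq_triple e1 e2 e3 (J1 y) (J2 y) (J3 y) \<and> Q c y = end_span3 (J1 y) (J2 y) (J3 y))) \<and>
     (\<forall>c\<in>A. \<forall>d\<in>A. \<forall>p\<in>fst c \<inter> fst d.
        Q c (snd c p) =
          {K. linear K \<and> (\<exists>L\<in>Q d (snd d p). \<forall>v. change c d p (K v) = L (change c d p v))})"

definition para_quaternionic_kaehler ::
    "nat \<Rightarrow> ('m::{t2_space, second_countable_topology}, 'e::euclidean_space) chart set \<Rightarrow>
     ('m, 'e) metric_field \<Rightarrow> ('m, 'e) end_bundle \<Rightarrow> bool" where
  "para_quaternionic_kaehler n A G Q \<longleftrightarrow>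
     DIM('e) = 4 * n \<and> smooth_structure A \<and> pseudo_riemannian A G \<and>
     (\<forall>c\<in>A. \<forall>x\<in>chart_image c. neutral (G c x)) \<and>
     almost_para_quaternionic A Q \<and>
     (\<forall>c\<in>A. \<forall>x\<in>chart_image c. \<forall>K\<in>Q c x. \<forall>u v. G c x (K u) v = - G c x u (K v)) \<and>
     (\<forall>c\<in>A. \<forall>V J. open V \<and> V \<subseteq> chart_image c \<and> smooth_section (Q c) V J \<longrightarrow>
        (\<forall>x\<in>V. \<forall>u. cov_deriv_end (G c) J x u \<in> Q c x))"

text \<open>A flat para-quaternionic Hermitian vector space: a coordinate-free form of \<open>\<H>\<^sup>n\<close>, where
  \<open>\<H>\<close> denotes the algebra of para-quaternions, \<open>h\<close> is the real part of the standard Hermitian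
  product and \<open>I1\<close>, \<open>I2\<close>, \<open>I3\<close> are the scalar multiplications by the imaginary units.\<close>

definition pq_hermitian_space ::
    "('e::euclidean_space \<Rightarrow> 'e \<Rightarrow> real) \<Rightarrow> ('e \<Rightarrow> 'e) \<Rightarrow> ('e \<Rightarrow> 'e) \<Rightarrow> ('e \<Rightarrow> 'e) \<Rightarrow> bool" where
  "pq_hermitian_space h I1 I2 I3 \<longleftrightarrow> scalar_product h \<and> pq_triple (-1) 1 1 I1 I2 I3 \<and>
     (\<forall>u v. h (I1 u) v = - h u (I1 v) \<and> h (I2 u) v = - h u (I2 v) \<and> h (I3 u) v = - h u (I3 v))"

text \<open>The standard metric of the para-quaternionic projective space, up to the real factor \<open>k\<close>, in
  the affine chart \<open>x \<mapsto> [1 : x]\<close> defined where \<open>1 + h x x \<noteq> 0\<close>. In homogeneous coordinates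
  \<open>q \<in> \<H>\<^bsup>n+1\<^esup>\<close> with flat scalar product \<open>\<eta>\<close>, the submersion metric induced from the pseudo-sphere
  \<open>\<eta> q q = 1\<close> is \<open>\<eta> u\<^sub>\<bottom> v\<^sub>\<bottom> / \<eta> q q\<close>, where \<open>\<bottom>\<close> denotes the part orthogonal to the line \<open>q\<H>\<close>; this
  line has the orthogonal basis \<open>q\<close>, \<open>I1 q\<close>, \<open>I2 q\<close>, \<open>I3 q\<close>, whose members have squared lengths
  \<open>\<eta> q q\<close> times \<open>1, 1, -1, -1\<close>. The formula below arises by taking \<open>q = (1, x)\<close> and tangent vectors
  \<open>(0, u)\<close>, \<open>(0, v)\<close>. All standard affine charts of the projective space give the same expression,
  and together they cover it.

  Negative \<open>k\<close> yields the dual para-quaternionic hyperbolic space: its metric is minus the above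
  one (with \<open>-h\<close> in place of \<open>h\<close>), since the flat product on its homogeneous coordinates is
  \<open>-1\<close> on the first coordinate and its points are represented by vectors with \<open>\<eta> q q = -1\<close>.

  In this chart the standard para-quaternionic structure is the constant span of the \<open>I\<close>'s: the
  tangent space at \<open>q\<H>\<close> consists of the \<open>\<H>\<close>-linear maps from \<open>q\<H>\<close> to the quotient by \<open>q\<H>\<close>,
  which is identified with \<open>\<H>\<^sup>n\<close> by the generator \<open>(1, x)\<close>.\<close>

definition projective_metric ::
    "real \<Rightarrow> ('e::euclidean_space \<Rightarrow> 'e \<Rightarrow> real) \<Rightarrow> ('e \<Rightarrow> 'e) \<Rightarrow> ('e \<Rightarrow> 'e) \<Rightarrow> ('e \<Rightarrow> 'e) \<Rightarrow>
     'e \<Rightarrow> 'e \<Rightarrow> 'e \<Rightarrow> real" where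
  "projective_metric k h I1 I2 I3 x u v =
     k * (h u v / (1 + h x x)
        - (h u x * h v x + h u (I1 x) * h v (I1 x) - h u (I2 x) * h v (I2 x) - h u (I3 x) * h v (I3 x))
          / (1 + h x x)\<^sup>2)"

text \<open>As the atlas is maximal, a local isometry onto an open subset of the model is the same as a
  chart in which metric and structure are those of the model. Isometries are understood to be
  isomorphisms of the whole structure, i.e. to preserve \<open>Q\<close> as well. The reduced scalar curvature of the
  model is not built in by a normalization of \<open>k\<close> but imposed on the given metric.\<close>

definition nonflat_pq_space_form ::
    "nat \<Rightarrow> real \<Rightarrow> ('m::{t2_space, second_countable_topology}, 'e::euclidean_space) chart set \<Rightarrow>
     ('m, 'e) metric_field \<Rightarrow> ('m, 'e) end_bundle \<Rightarrow> bool" where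
  "nonflat_pq_space_form n \<nu> A G Q \<longleftrightarrow>
     para_quaternionic_kaehler n A G Q \<and> \<nu> \<noteq> 0 \<and>
     (\<exists>k h I1 I2 I3. k \<noteq> 0 \<and> pq_hermitian_space h I1 I2 I3 \<and>
        (\<forall>p. \<exists>c\<in>A. p \<in> fst c \<and>
           (\<forall>x\<in>chart_image c. 1 + h x x \<noteq> 0 \<and> G c x = projective_metric k h I1 I2 I3 x \<and>
              Q c x = end_span3 I1 I2 I3))) \<and>
     (\<forall>c\<in>A. \<forall>x\<in>chart_image c. reduced_scalar_curvature n (G c) x = \<nu>)"


section \<open>Almost \<open>\<epsilon>\<close>-Hermitian and totally \<open>\<epsilon>\<close>-complex submanifolds\<close>

text \<open>The section \<open>J\<close> along the immersion \<open>f\<close> is given by its components \<open>J p c\<close> at \<open>f p\<close> in the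
  charts \<open>c\<close> around \<open>f p\<close>.\<close>

definition section_along ::
    "('k::topological_space, 'd::euclidean_space) chart set \<Rightarrow>
     ('m::topological_space, 'e::euclidean_space) chart set \<Rightarrow> ('m, 'e) end_bundle \<Rightarrow>
     ('k \<Rightarrow> 'm) \<Rightarrow> ('k \<Rightarrow> ('m, 'e) chart \<Rightarrow> 'e \<Rightarrow> 'e) \<Rightarrow> bool" where
  "section_along B A Q f J \<longleftrightarrow>
     (\<forall>c\<in>A. \<forall>p\<in>f -` fst c. J p c \<in> Q c (snd c (f p))) \<and>
     (\<forall>c\<in>A. \<forall>d\<in>A. \<forall>p\<in>f -` (fst c \<inter> fst d). \<forall>v.
        change c d (f p) (J p c v) = J p d (change c d (f p) v)) \<and>
     (\<forall>b\<in>B. \<forall>c\<in>A. \<forall>v. smooth_on (snd b ` (fst b \<inter> f -` fst c)) (\<lambda>y. J (chart_inv b y) c v))"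

definition almost_hermitian_submanifold ::
    "real \<Rightarrow> ('k::{t2_space, second_countable_topology}, 'd::euclidean_space) chart set \<Rightarrow>
     ('m::topological_space, 'e::euclidean_space) chart set \<Rightarrow> ('m, 'e) metric_field \<Rightarrow>
     ('m, 'e) end_bundle \<Rightarrow> ('k \<Rightarrow> 'm) \<Rightarrow> ('k \<Rightarrow> ('m, 'e) chart \<Rightarrow> 'e \<Rightarrow> 'e) \<Rightarrow> bool" where
  "almost_hermitian_submanifold \<epsilon> B A G Q f J \<longleftrightarrow>
     smooth_structure B \<and> immersion B A f \<and> section_along B A Q f J \<and>
     (\<forall>c\<in>A. \<forall>p\<in>f -` fst c.
        nondegenerate_on (G c (snd c (f p))) (tangent_space B f c p) \<and>
        J p c ` tangent_space B f c p = tangent_space B f c p \<and>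
        (\<forall>v. J p c (J p c v) = \<epsilon> *\<^sub>R v))"

definition adapted_basis :: "real \<Rightarrow> ('e::real_vector \<Rightarrow> 'e) set \<Rightarrow> ('e \<Rightarrow> 'e) \<Rightarrow>
     ('e \<Rightarrow> 'e) \<Rightarrow> ('e \<Rightarrow> 'e) \<Rightarrow> ('e \<Rightarrow> 'e) \<Rightarrow> bool" where
  "adapted_basis \<epsilon> Qp J J1 J2 J3 \<longleftrightarrow>
     J1 = J \<and> pq_triple \<epsilon> 1 (- \<epsilon>) J1 J2 J3 \<and> Qp = end_span3 J1 J2 J3"

definition totally_complex_submanifold ::
    "nat \<Rightarrow> real \<Rightarrow> ('k::{t2_space, second_countable_topology}, 'd::euclidean_space) chart set \<Rightarrow>
     ('m::topological_space, 'e::euclidean_space) chart set \<Rightarrow> ('m, 'e) metric_field \<Rightarrow>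
     ('m, 'e) end_bundle \<Rightarrow> ('k \<Rightarrow> 'm) \<Rightarrow> ('k \<Rightarrow> ('m, 'e) chart \<Rightarrow> 'e \<Rightarrow> 'e) \<Rightarrow> bool" where
  "totally_complex_submanifold n \<epsilon> B A G Q f J \<longleftrightarrow>
     DIM('d) = 2 * n \<and> almost_hermitian_submanifold \<epsilon> B A G Q f J \<and>
     (\<forall>c\<in>A. \<forall>p\<in>f -` fst c. \<forall>J1 J2 J3.
        adapted_basis \<epsilon> (Q c (snd c (f p))) (J p c) J1 J2 J3 \<longrightarrow>
        (\<forall>X\<in>tangent_space B f c p. J2 X \<in> orth_complement (G c (snd c (f p))) (tangent_space B f c p)))"

end

theory Submission
  imports Defs
begin

text \<open>The curvature tensor of the space form is \<open>\<nu>\<close> times the algebraic tensor \<open>pq_curvature\<close> (the tensor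
\<open>R\<^sub>0\<close>), and the four assertions are what is left of this formula on a totally complex subspace.

\<^bold>\<open>The algebra.\<close> Write \<open>T\<close> for the tangent space and \<open>N\<close> for its orthogonal complement. As \<open>J\<^sub>1\<close> is skew and
preserves \<open>T\<close>, it preserves \<open>N\<close>, whereas \<open>J\<^sub>2\<close> and hence \<open>J\<^sub>3 = J\<^sub>1 J\<^sub>2\<close> map \<open>T\<close> into \<open>N\<close>. For \<open>X\<close>, \<open>Y\<close> in \<open>T\<close>
each summand of \<open>R\<^sub>0(X, Y) Z\<close> therefore either vanishes or stays on the side of \<open>Z\<close>; reading off the
survivors gives all components of the curvature, and the Ricci tensor follows by a trace in which the skew
map \<open>J\<^sub>1\<close> on \<open>T\<close> contributes nothing (\<open>totally_complex_curvature\<close>).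

\<^bold>\<open>The curvature tensor of a space form.\<close> The metric is given by a formula only in affine charts of the
model. There the Levi-Civita connection is explicit, by analogy with projective geometry: with
\<open>r = 1 / (1 + h x x)\<close> it is \<open>- r\<close> times \<open>u\<langle>x, v\<rangle> + v\<langle>x, u\<rangle>\<close>, where \<open>\<langle>x, v\<rangle>\<close> is the para-quaternionic
product. Its curvature is a polynomial in \<open>r\<close> with a linear and a quadratic part, and these are the linear
and the quadratic part of \<open>4 R\<^sub>0\<close> formed with the metric divided by its scale \<open>k\<close>
(\<open>riemann_projective\<close>). So the curvature is \<open>(4 / k) R\<^sub>0\<close>, and contracting twice shows that \<open>4 / k\<close> is the
reduced scalar curvature (\<open>reduced_scalar_curvature_pq\<close>).

\<^bold>\<open>Arbitrary charts and bases.\<close> The curvature tensor, computed from Christoffel symbols, has to be shown to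
be a tensor (\<open>riemann_pullback\<close>); this rests on the symmetry of second derivatives, applied to the change
of charts and to its first derivatives. Finally \<open>R\<^sub>0\<close> has to be rewritten in an adapted basis: its
dependence on the basis is through \<open>\<Sum>\<^sub>\<alpha> \<epsilon>\<^sub>\<alpha> J\<^sub>\<alpha> \<otimes> J\<^sub>\<alpha>\<close>, the Casimir element of a quadratic form on \<open>Q\<close>, which is
the same for all bases (\<open>clifford_casimir\<close>).\<close>

section \<open>Traces and skew endomorphisms for an indefinite scalar product\<close>

lemma scalar_product_eqI:
  assumes "scalar_product g" "\<And>z. g v z = g w z"
  shows "v = w"
proof -
  have bil: "bilinear g" and nd: "\<And>u. (\<forall>v. g u v = 0) \<Longrightarrow> u = 0"
    using assms(1) unfolding scalar_product_def by blast+
  have "v - w = 0"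
    by (rule nd) (simp add: bilinear_lsub[OF bil] assms(2))
  then show ?thesis by simp
qed

lemma trace_on_basis:
  fixes W :: "'e::euclidean_space set"
  assumes "subspace W"
  obtains B where "finite B" "independent B" "span B = W" "card B = dim W"
    "\<And>L. trace_on W L = (\<Sum>b\<in>B. representation B (L b) b)"
proof -
  define B where "B = (SOME B. B \<subseteq> W \<and> independent B \<and> span B = W)"
  have "\<exists>B. B \<subseteq> W \<and> independent B \<and> span B = W"
    using basis_exists[of W] assms by (metis span_subspace)
  then have B: "B \<subseteq> W \<and> independent B \<and> span B = W" unfolding B_def by (rule someI_ex)
  then show ?thesis
    using that[of B] independent_imp_finite dim_span_eq_card_independent
    unfolding trace_on_def B_def[symmetric] Let_def by metis
qed

lemma trace_on_cong:
  assumes "subspace W" "\<And>z. z \<in> W \<Longrightarrow> L z = L' z"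
  shows "trace_on W L = trace_on W L'"
proof (rule trace_on_basis[OF assms(1)])
  fix B assume "span B = W" and tr: "\<And>L. trace_on W L = (\<Sum>b\<in>B. representation B (L b) b)"
  then show ?thesis unfolding tr using assms(2) span_base by (metis (no_types, lifting) sum.cong)
qed

lemma trace_on_add:
  assumes "subspace W" "\<And>z. z \<in> W \<Longrightarrow> L z \<in> W" "\<And>z. z \<in> W \<Longrightarrow> L' z \<in> W"
  shows "trace_on W (\<lambda>z. L z + L' z) = trace_on W L + trace_on W L'"
proof (rule trace_on_basis[OF assms(1)])
  fix B assume B: "independent B" "span B = W" and tr: "\<And>L. trace_on W L = (\<Sum>b\<in>B. representation B (L b) b)"
  have "representation B (L b + L' b) b = representation B (L b) b + representation B (L' b) b" if "b \<in> B" for b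
    using B assms that by (subst representation_add) (auto intro: span_base)
  then show ?thesis unfolding tr by (simp add: sum.distrib)
qed

lemma trace_on_scale:
  assumes "subspace W" "\<And>z. z \<in> W \<Longrightarrow> L z \<in> W"
  shows "trace_on W (\<lambda>z. r *\<^sub>R L z) = r * trace_on W L"
proof (rule trace_on_basis[OF assms(1)])
  fix B assume B: "independent B" "span B = W" and tr: "\<And>L. trace_on W L = (\<Sum>b\<in>B. representation B (L b) b)"
  have "representation B (r *\<^sub>R L b) b = r * representation B (L b) b" if "b \<in> B" for b
    using B assms that by (subst representation_scale) (auto intro: span_base)
  then show ?thesis unfolding tr by (simp add: sum_distrib_left)
qed

lemma trace_on_id:
  assumes "subspace W"
  shows "trace_on W (\<lambda>z. z) = real (dim W)"
proof (rule trace_on_basis[OF assms(1)])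
  fix B assume B: "independent B" "span B = W" "card B = dim W"
    and tr: "\<And>L. trace_on W L = (\<Sum>b\<in>B. representation B (L b) b)"
  have "representation B b b = 1" if "b \<in> B" for b
    using representation_basis[OF B(1) that] by simp
  then show ?thesis unfolding tr using B by simp
qed

text \<open>Every trace below is computed by writing the endomorphism as a sum of such rank-one maps, multiples of the
identity and skew maps.\<close>

lemma trace_on_rank_one:
  fixes \<phi> :: "'e::euclidean_space \<Rightarrow> real"
  assumes "subspace W" "linear \<phi>" "a \<in> W"
  shows "trace_on W (\<lambda>z. \<phi> z *\<^sub>R a) = \<phi> a"
proof (rule trace_on_basis[OF assms(1)])
  fix B assume B: "finite B" "independent B" "span B = W" "card B = dim W"
    and tr: "\<And>L. trace_on W L = (\<Sum>b\<in>B. representation B (L b) b)"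
  have "\<phi> a = \<phi> (\<Sum>b\<in>B. representation B a b *\<^sub>R b)"
    using sum_representation_eq[OF B(2) _ B(1) subset_refl, of a] assms(3) B(3) by simp
  also have "\<dots> = (\<Sum>b\<in>B. representation B a b * \<phi> b)"
    using assms(2) by (simp add: linear_sum linear_cmul)
  finally show ?thesis unfolding tr using B assms(3)
    by (simp add: representation_scale mult.commute)
qed

text \<open>The map that sends \<open>w\<close> to the vector with coefficients \<open>g w b\<close> is injective by non-degeneracy, hence maps
\<open>W\<close> onto itself; the dual vectors are the preimages of the basis vectors.\<close>

lemma dual_basis:
  fixes g :: "'e::euclidean_space \<Rightarrow> 'e \<Rightarrow> real"
  assumes g: "bilinear g" "nondegenerate_on g W"
    and B: "finite B" "independent B" "span B = W"
  obtains D where "\<And>b. b \<in> B \<Longrightarrow> D b \<in> W" "\<And>b c. b \<in> B \<Longrightarrow> c \<in> B \<Longrightarrow> g (D b) c = (if b = c then 1 else 0)"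
proof -
  define L where "L w = (\<Sum>b\<in>B. g w b *\<^sub>R b)" for w
  have W: "subspace W" using B(3) subspace_span by blast
  have coeff: "c b = c' b" if "(\<Sum>b\<in>B. c b *\<^sub>R b) = (\<Sum>b\<in>B. c' b *\<^sub>R b)" "b \<in> B" for c c' :: "'e \<Rightarrow> real" and b
  proof -
    have "(\<Sum>b\<in>B. (c b - c' b) *\<^sub>R b) = 0" using that(1) by (simp add: scaleR_diff_left sum_subtractf)
    then show ?thesis using independentD[OF B(2) B(1) subset_refl] that(2) by fastforce
  qed
  have lin: "linear L"
    unfolding L_def
    by (intro linearI) (simp_all add: bilinear_ladd[OF g(1)] bilinear_lmul[OF g(1)] scaleR_add_left
        sum.distrib scaleR_sum_right)
  have LW: "L ` W \<subseteq> W" unfolding L_def using B(3) W by (auto intro!: subspace_sum subspace_scale intro: span_base)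
  have inj: "w = 0" if "w \<in> W" "L w = 0" for w
  proof -
    have z: "g w b = 0" if "b \<in> B" for b
      using coeff[of "g w" "\<lambda>_. 0" b] \<open>L w = 0\<close> that by (simp add: L_def)
    have "g w v = 0" if "v \<in> span B" for v
      using \<open>v \<in> span B\<close> by (induction rule: span_induct_alt)
        (simp_all add: z bilinear_rzero[OF g(1)] bilinear_radd[OF g(1)] bilinear_rmul[OF g(1)])
    then show ?thesis using g(2) that(1) B(3) unfolding nondegenerate_on_def by blast
  qed
  have "inj_on L W"
    using linear_inj_on_iff_eq_0[OF lin W] inj by blast
  then have "dim (L ` W) = dim W" using dim_image_eq[OF lin] W by (simp add: span_eq_iff[THEN iffD2])
  then have "L ` W = W" using subspace_dim_equal[OF linear_subspace_image[OF lin W] W LW] by simp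
  then have "\<forall>b\<in>B. \<exists>w\<in>W. L w = b" using B(3) span_base by (metis imageE)
  then obtain D where D: "\<And>b. b \<in> B \<Longrightarrow> D b \<in> W \<and> L (D b) = b" by metis
  have "g (D b) c = (if b = c then 1 else 0)" if "b \<in> B" "c \<in> B" for b c
  proof -
    have "(\<Sum>c\<in>B. g (D b) c *\<^sub>R c) = (\<Sum>c\<in>B. (if b = c then 1 else 0) *\<^sub>R c)"
      using D[OF that(1)] B(1) that(1) by (simp add: L_def if_distrib[of "\<lambda>r. r *\<^sub>R _"] sum.delta' cong: if_cong)
    then show ?thesis using coeff[of "g (D b)" "\<lambda>c. if b = c then 1 else 0"] that by simp
  qed
  then show thesis using that D by blast
qed

text \<open>Expressing the basis vectors themselves through the dual basis turns the trace into
\<open>\<Sum>\<^sub>b\<^sub>,\<^sub>c g(b, c) g(b', L c')\<close>, where \<open>b'\<close> and \<open>c'\<close> are dual to \<open>b\<close> and \<open>c\<close>: a symmetric matrix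
contracted with a skew one.\<close>

lemma trace_on_skew:
  assumes g: "bilinear g" "\<And>u v. g u v = g v u" "nondegenerate_on g W" and W: "subspace W"
    and L: "linear L" "\<And>z. z \<in> W \<Longrightarrow> L z \<in> W" "\<And>u v. g (L u) v = - g u (L v)"
  shows "trace_on W (L :: 'e::euclidean_space \<Rightarrow> 'e) = 0"
proof (rule trace_on_basis[OF W])
  fix B assume B: "finite B" "independent B" "span B = W"
    and tr: "\<And>L. trace_on W L = (\<Sum>b\<in>B. representation B (L b) b)"
  obtain D where D: "\<And>b. b \<in> B \<Longrightarrow> D b \<in> W" "\<And>b c. b \<in> B \<Longrightarrow> c \<in> B \<Longrightarrow> g (D b) c = (if b = c then 1 else 0)"
    using dual_basis[OF g(1,3) B] by metis
  have sumr: "g u (\<Sum>c\<in>B. h c *\<^sub>R w c) = (\<Sum>c\<in>B. h c * g u (w c))" for u h w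
    using g(1) unfolding bilinear_def by (simp add: linear_sum linear_cmul)
  have rep: "representation B v b = g (D b) v" if "v \<in> W" "b \<in> B" for v b
  proof -
    have "g (D b) v = g (D b) (\<Sum>c\<in>B. representation B v c *\<^sub>R c)"
      using sum_representation_eq[OF B(2) _ B(1) subset_refl, of v] that B(3) by simp
    also have "\<dots> = (\<Sum>c\<in>B. representation B v c * (if b = c then 1 else 0))"
      unfolding sumr using D(2)[OF that(2)] by simp
    also have "\<dots> = representation B v b"
      using that B(1) by (simp add: if_distrib[of "\<lambda>r. _ * r"] cong: if_cong)
    finally show ?thesis by simp
  qed
  have expand: "b = (\<Sum>c\<in>B. g b c *\<^sub>R D c)" if "b \<in> B" for b
  proof -
    let ?d = "b - (\<Sum>c\<in>B. g b c *\<^sub>R D c)"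
    have d: "?d \<in> W" using that B(3) D(1) W
      by (intro subspace_diff[OF W] subspace_sum subspace_scale[OF W]) (auto intro: span_base)
    have z: "g ?d e = 0" if "e \<in> B" for e
    proof -
      have "g ?d e = g b e - g e (\<Sum>c\<in>B. g b c *\<^sub>R D c)"
        using bilinear_lsub[OF g(1)] g(2) by metis
      also have "\<dots> = g b e - (\<Sum>c\<in>B. g b c * g (D c) e)"
        unfolding sumr using g(2) by simp
      also have "(\<Sum>c\<in>B. g b c * g (D c) e) = (\<Sum>c\<in>B. g b c * (if c = e then 1 else 0))"
        using D(2) that by (intro sum.cong) auto
      also have "\<dots> = g b e"
        using that B(1) by (simp add: if_distrib[of "\<lambda>r. _ * r"] cong: if_cong)
      finally show ?thesis by simp
    qed
    have "g ?d v = 0" if "v \<in> span B" for v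
      using \<open>v \<in> span B\<close> by (induction rule: span_induct_alt)
        (simp_all add: z bilinear_rzero[OF g(1)] bilinear_radd[OF g(1)] bilinear_rmul[OF g(1)])
    then have "?d = 0" using d g(3) B(3) unfolding nondegenerate_on_def by blast
    then show ?thesis by simp
  qed
  define S where "S = (\<Sum>b\<in>B. \<Sum>c\<in>B. g b c * g (D b) (L (D c)))"
  have "trace_on W L = (\<Sum>b\<in>B. g (D b) (L b))"
    unfolding tr using rep L(2) B(3) by (intro sum.cong) (auto intro: span_base)
  also have "\<dots> = S"
    unfolding S_def
  proof (rule sum.cong)
    fix b assume "b \<in> B"
    then have "L b = L (\<Sum>c\<in>B. g b c *\<^sub>R D c)" using expand by simp
    also have "\<dots> = (\<Sum>c\<in>B. g b c *\<^sub>R L (D c))" using L(1) by (simp add: linear_sum linear_cmul)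
    finally show "g (D b) (L b) = (\<Sum>c\<in>B. g b c * g (D b) (L (D c)))" using sumr by simp
  qed simp
  finally have "trace_on W L = S" .
  moreover have "S = - S"
  proof -
    have "S = (\<Sum>c\<in>B. \<Sum>b\<in>B. g b c * g (D b) (L (D c)))" unfolding S_def by (rule sum.swap)
    also have "\<dots> = (\<Sum>c\<in>B. \<Sum>b\<in>B. - (g c b * g (D c) (L (D b))))"
    proof (intro sum.cong refl)
      fix b c
      show "g b c * g (D b) (L (D c)) = - (g c b * g (D c) (L (D b)))"
        using L(3)[of "D b" "D c"] g(2)[of "L (D b)" "D c"] g(2)[of b c] by simp
    qed
    finally show ?thesis unfolding S_def by (simp add: sum_negf)
  qed
  ultimately show ?thesis by simp
qed

section \<open>Para-quaternionic triples and their curvature tensor\<close>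

text \<open>Anticommutators identify the transition coefficients in the two directions: the anticommutator of \<open>J a\<close>
and \<open>I b\<close> can be evaluated after expanding either of them, which gives \<open>n b a * e a = m a b * e' b\<close>. Since the
signs square to one, this rewrites the coefficients in one direction through those in the other, up to
signs, and the sum over one basis turns into the sum over the other.\<close>

lemma clifford_casimir:
  fixes J I :: "'i \<Rightarrow> 'e::euclidean_space \<Rightarrow> 'e"
  assumes "finite K"
    and lin: "\<And>a. a \<in> K \<Longrightarrow> linear (J a)" "\<And>a. a \<in> K \<Longrightarrow> linear (I a)"
    and J: "\<And>a b v. a \<in> K \<Longrightarrow> b \<in> K \<Longrightarrow> J a (J b v) + J b (J a v) = (if a = b then 2 * e a else 0) *\<^sub>R v"
    and I: "\<And>a b v. a \<in> K \<Longrightarrow> b \<in> K \<Longrightarrow> I a (I b v) + I b (I a v) = (if a = b then 2 * e' a else 0) *\<^sub>R v"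
    and e: "\<And>a. a \<in> K \<Longrightarrow> e a * e a = 1" "\<And>a. a \<in> K \<Longrightarrow> e' a * e' a = 1"
    and m: "\<And>a v. a \<in> K \<Longrightarrow> J a v = (\<Sum>b\<in>K. m a b *\<^sub>R I b v)"
    and n: "\<And>b v. b \<in> K \<Longrightarrow> I b v = (\<Sum>a\<in>K. n b a *\<^sub>R J a v)"
    and \<phi>: "linear (\<phi> :: 'e \<Rightarrow> real)"
  shows "(\<Sum>a\<in>K. (e a * \<phi> (J a X)) *\<^sub>R J a Z) = (\<Sum>b\<in>K. (e' b * \<phi> (I b X)) *\<^sub>R I b Z)"
proof -
  have rel: "e a * m a b = e' b * n b a" if ab: "a \<in> K" "b \<in> K" for a b
  proof -
    obtain v :: 'e where v: "v \<noteq> 0" using nonzero_Basis SOME_Basis by blast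
    have "J a (I b v) + I b (J a v) = (\<Sum>c\<in>K. n b c *\<^sub>R (J a (J c v) + J c (J a v)))"
      unfolding n[OF ab(2)] by (simp add: linear_sum[OF lin(1)[OF ab(1)]] linear_cmul[OF lin(1)[OF ab(1)]]
        scaleR_add_right sum.distrib)
    also have "\<dots> = (\<Sum>c\<in>K. (if a = c then n b c * (2 * e a) else 0) *\<^sub>R v)"
      by (rule sum.cong) (auto simp: J[OF ab(1)])
    also have "\<dots> = (n b a * (2 * e a)) *\<^sub>R v" using ab assms(1) by (simp flip: scaleR_sum_left)
    finally have 1: "J a (I b v) + I b (J a v) = (n b a * (2 * e a)) *\<^sub>R v" .
    have "J a (I b v) + I b (J a v) = (\<Sum>c\<in>K. m a c *\<^sub>R (I b (I c v) + I c (I b v)))"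
      unfolding m[OF ab(1)] by (simp add: linear_sum[OF lin(2)[OF ab(2)]] linear_cmul[OF lin(2)[OF ab(2)]]
        scaleR_add_right sum.distrib add.commute)
    also have "\<dots> = (\<Sum>c\<in>K. (if b = c then m a c * (2 * e' b) else 0) *\<^sub>R v)"
      by (rule sum.cong) (auto simp: I[OF ab(2)])
    also have "\<dots> = (m a b * (2 * e' b)) *\<^sub>R v" using ab assms(1) by (simp flip: scaleR_sum_left)
    finally have "n b a * e a = m a b * e' b" using 1 v by simp
    then have "e a * e' b * (n b a * e a) = e a * e' b * (m a b * e' b)" by simp
    then have "(e a * e a) * (e' b * n b a) = (e' b * e' b) * (e a * m a b)" by (simp only: ac_simps)
    then show ?thesis using e(1)[OF ab(1)] e(2)[OF ab(2)] by simp
  qed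
  have "(\<Sum>a\<in>K. (e a * \<phi> (J a X)) *\<^sub>R J a Z) = (\<Sum>a\<in>K. (e a * \<phi> (J a X)) *\<^sub>R (\<Sum>b\<in>K. m a b *\<^sub>R I b Z))"
    by (rule sum.cong) (auto simp flip: m)
  also have "\<dots> = (\<Sum>a\<in>K. \<Sum>b\<in>K. ((e a * m a b) * \<phi> (J a X)) *\<^sub>R I b Z)"
    by (simp add: scaleR_sum_right ac_simps)
  also have "\<dots> = (\<Sum>b\<in>K. \<Sum>a\<in>K. ((e' b * n b a) * \<phi> (J a X)) *\<^sub>R I b Z)"
    by (subst sum.swap) (auto intro!: sum.cong simp: rel)
  also have "\<dots> = (\<Sum>b\<in>K. (e' b * \<phi> (\<Sum>a\<in>K. n b a *\<^sub>R J a X)) *\<^sub>R I b Z)"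
    by (simp add: linear_sum[OF \<phi>] linear_cmul[OF \<phi>] sum_distrib_left scaleR_sum_left ac_simps)
  also have "\<dots> = (\<Sum>b\<in>K. (e' b * \<phi> (I b X)) *\<^sub>R I b Z)"
    by (rule sum.cong) (auto simp flip: n)
  finally show ?thesis .
qed

lemma pq_tripleD:
  assumes "pq_triple e1 e2 e3 J1 J2 J3"
  shows "linear J1" "linear J2" "linear J3"
    "e1 * e1 = 1" "e2 * e2 = 1" "e3 * e3 = 1"
    "J1 (J1 v) = e1 *\<^sub>R v" "J2 (J2 v) = e2 *\<^sub>R v" "J3 (J3 v) = e3 *\<^sub>R v"
    "J1 (J2 v) = J3 v" "J2 (J1 v) = - J3 v"
    "J2 (J3 v) = - J3 (J2 v)" "J3 (J1 v) = - J1 (J3 v)"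
    "e1 * e2 = - e3"
proof -
  have a: "\<forall>v. J1 (J2 v) = - J2 (J1 v) \<and> J2 (J3 v) = - J3 (J2 v) \<and> J3 (J1 v) = - J1 (J3 v)"
   "\<forall>v. J3 v = J1 (J2 v)"
    using assms unfolding pq_triple_def by blast+
  show "J2 (J1 v) = - J3 v" "J1 (J2 v) = J3 v" using a by (metis minus_minus)+
  show "J2 (J3 v) = - J3 (J2 v)" "J3 (J1 v) = - J1 (J3 v)" using a(1) by blast+
qed (use assms in \<open>auto simp: pq_triple_def\<close>)

text \<open>Indexing a triple by \<open>1, 2, 3\<close> makes \<open>clifford_casimir\<close> applicable to triples.\<close>

definition pick3 :: "'z \<Rightarrow> 'z \<Rightarrow> 'z \<Rightarrow> nat \<Rightarrow> 'z" where
  "pick3 x y z i = (if i = 1 then x else if i = 2 then y else z)"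

lemma sum_pick3: "(\<Sum>i\<in>{1,2,3}. F i) = F 1 + F 2 + F (3::nat)" for F :: "nat \<Rightarrow> 'b::ab_group_add"
  by (simp add: add.assoc)

lemma pq_clifford:
  assumes "pq_triple e1 e2 e3 J1 J2 J3" and "a \<in> {1,2,3}" "b \<in> {1,2,3}"
  shows "pick3 J1 J2 J3 a (pick3 J1 J2 J3 b v) + pick3 J1 J2 J3 b (pick3 J1 J2 J3 a v) =
    (if a = b then 2 * pick3 e1 e2 e3 a else 0) *\<^sub>R v"
proof -
  have two: "e *\<^sub>R v + e *\<^sub>R v = (2 * e) *\<^sub>R v" for e by (simp flip: scaleR_add_left)
  note D = pq_tripleD[OF assms(1)]
  show ?thesis using assms(2,3) by (elim insertE) (simp_all add: pick3_def two D(7-13))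
qed

lemma end_span3_pick3:
  fixes J1 J2 J3 I1 I2 I3 :: "'a::real_vector \<Rightarrow> 'a"
  assumes "{J1, J2, J3} \<subseteq> end_span3 I1 I2 I3"
  obtains m where "\<And>a v. a \<in> {1,2,3} \<Longrightarrow>
    pick3 J1 J2 J3 a v = (\<Sum>b\<in>{1,2,3}. m a b *\<^sub>R pick3 I1 I2 I3 b v)"
proof -
  have "\<exists>m. \<forall>v. J v = (\<Sum>b\<in>{1,2,3}. m b *\<^sub>R pick3 I1 I2 I3 b v)" if "J \<in> end_span3 I1 I2 I3" for J :: "'a \<Rightarrow> 'a"
  proof -
    from that obtain a b c where "J = (\<lambda>v. a *\<^sub>R I1 v + b *\<^sub>R I2 v + c *\<^sub>R I3 v)"
      unfolding end_span3_def mem_Collect_eq by (elim exE conjE) (rule that)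
    then show ?thesis by (intro exI[of _ "pick3 a b c"]) (simp add: pick3_def add.assoc)
  qed
  then have "\<forall>a. \<exists>m. \<forall>v. pick3 J1 J2 J3 a v = (\<Sum>b\<in>{1,2,3}. m b *\<^sub>R pick3 I1 I2 I3 b v)"
    using assms unfolding pick3_def[of J1 J2 J3] by auto
  then obtain m where "\<forall>a v. pick3 J1 J2 J3 a v = (\<Sum>b\<in>{1,2,3}. m a b *\<^sub>R pick3 I1 I2 I3 b v)"
    by (rule choice[THEN exE]) (rule that)
  then show thesis using that[of m] by blast
qed

lemma pq_casimir:
  fixes J1 J2 J3 I1 I2 I3 :: "'e::euclidean_space \<Rightarrow> 'e"
  assumes J: "pq_triple e1 e2 e3 J1 J2 J3" and I: "pq_triple d1 d2 d3 I1 I2 I3"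
    and JI: "{J1, J2, J3} \<subseteq> end_span3 I1 I2 I3" and IJ: "{I1, I2, I3} \<subseteq> end_span3 J1 J2 J3"
    and \<phi>: "linear (\<phi> :: 'e \<Rightarrow> real)"
  shows "(e1 * \<phi> (J1 X)) *\<^sub>R J1 Z + (e2 * \<phi> (J2 X)) *\<^sub>R J2 Z + (e3 * \<phi> (J3 X)) *\<^sub>R J3 Z =
    (d1 * \<phi> (I1 X)) *\<^sub>R I1 Z + (d2 * \<phi> (I2 X)) *\<^sub>R I2 Z + (d3 * \<phi> (I3 X)) *\<^sub>R I3 Z"
proof -
  obtain m where m: "\<And>a v. a \<in> {1,2,3} \<Longrightarrow>
    pick3 J1 J2 J3 a v = (\<Sum>b\<in>{1,2,3}. m a b *\<^sub>R pick3 I1 I2 I3 b v)"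
    using end_span3_pick3[OF JI] by blast
  obtain n where n: "\<And>a v. a \<in> {1,2,3} \<Longrightarrow>
    pick3 I1 I2 I3 a v = (\<Sum>b\<in>{1,2,3}. n a b *\<^sub>R pick3 J1 J2 J3 b v)"
    using end_span3_pick3[OF IJ] by blast
  have "(\<Sum>a\<in>{1,2,3}. (pick3 e1 e2 e3 a * \<phi> (pick3 J1 J2 J3 a X)) *\<^sub>R pick3 J1 J2 J3 a Z) =
    (\<Sum>b\<in>{1,2,3}. (pick3 d1 d2 d3 b * \<phi> (pick3 I1 I2 I3 b X)) *\<^sub>R pick3 I1 I2 I3 b Z)"
  proof (rule clifford_casimir)
  qed (fact pq_clifford[OF J] pq_clifford[OF I] m n \<phi> |
      simp add: pick3_def pq_tripleD(1-6)[OF J] pq_tripleD(1-6)[OF I])+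
  then show ?thesis by (simp add: sum_pick3 pick3_def add.assoc)
qed

text \<open>The tensor \<open>R\<^sub>0\<close> that is the curvature tensor of the space form with reduced scalar curvature one.\<close>

definition pq_curvature ::
    "real \<Rightarrow> real \<Rightarrow> real \<Rightarrow> ('e::real_vector \<Rightarrow> 'e \<Rightarrow> real) \<Rightarrow> ('e \<Rightarrow> 'e) \<Rightarrow> ('e \<Rightarrow> 'e) \<Rightarrow> ('e \<Rightarrow> 'e) \<Rightarrow>
     'e \<Rightarrow> 'e \<Rightarrow> 'e \<Rightarrow> 'e" where
  "pq_curvature e1 e2 e3 g J1 J2 J3 X Y Z =
     (1/2) *\<^sub>R ((e1 * g (J1 X) Y) *\<^sub>R J1 Z + (e2 * g (J2 X) Y) *\<^sub>R J2 Z + (e3 * g (J3 X) Y) *\<^sub>R J3 Z)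
     + (1/4) *\<^sub>R (wedge g X Y Z - (e1 *\<^sub>R wedge g (J1 X) (J1 Y) Z + e2 *\<^sub>R wedge g (J2 X) (J2 Y) Z
         + e3 *\<^sub>R wedge g (J3 X) (J3 Y) Z))"

text \<open>Both the first sum and the wedge products are contractions of \<open>\<Sum>\<^sub>\<alpha> \<epsilon>\<^sub>\<alpha> J\<^sub>\<alpha> \<otimes> J\<^sub>\<alpha>\<close> with functionals of the
form \<open>g(_, w)\<close>, so \<open>pq_casimir\<close> applies to each of them.\<close>

lemma pq_curvature_basis_independent:
  fixes J1 J2 J3 I1 I2 I3 :: "'e::euclidean_space \<Rightarrow> 'e"
  assumes "pq_triple e1 e2 e3 J1 J2 J3" "pq_triple d1 d2 d3 I1 I2 I3"
    and "{J1, J2, J3} \<subseteq> end_span3 I1 I2 I3" "{I1, I2, I3} \<subseteq> end_span3 J1 J2 J3"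
    and g: "bilinear g"
  shows "pq_curvature e1 e2 e3 g J1 J2 J3 X Y Z = pq_curvature d1 d2 d3 g I1 I2 I3 X Y Z"
proof -
  have lin: "linear (\<lambda>v. g v w)" for w using g unfolding bilinear_def by blast
  note C = pq_casimir[OF assms(1-4) lin]
  have w: "e1 *\<^sub>R wedge g (K1 X) (K1 Y) Z + e2 *\<^sub>R wedge g (K2 X) (K2 Y) Z + e3 *\<^sub>R wedge g (K3 X) (K3 Y) Z =
    ((e1 * g (K1 Y) Z) *\<^sub>R K1 X + (e2 * g (K2 Y) Z) *\<^sub>R K2 X + (e3 * g (K3 Y) Z) *\<^sub>R K3 X)
    - ((e1 * g (K1 X) Z) *\<^sub>R K1 Y + (e2 * g (K2 X) Z) *\<^sub>R K2 Y + (e3 * g (K3 X) Z) *\<^sub>R K3 Y)"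
    for e1 e2 e3 K1 K2 K3
    by (simp add: wedge_def algebra_simps)
  show ?thesis unfolding pq_curvature_def w C ..
qed

text \<open>In dimension \<open>4 n\<close> this is the Einstein constant \<open>n + 2\<close>. The part \<open>X \<and> Y\<close> contributes
\<open>(4 n - 1) / 4\<close>; each \<open>J\<^sub>\<alpha>\<close> contributes \<open>1 / 2\<close> from the first sum and \<open>1 / 4\<close> from its wedge
product.\<close>

lemma trace_pq_curvature:
  fixes g :: "'e::euclidean_space \<Rightarrow> 'e \<Rightarrow> real"
  assumes g: "scalar_product g" and J: "pq_triple e1 e2 e3 J1 J2 J3"
    and sk: "\<And>u v. g (J1 u) v = - g u (J1 v)" "\<And>u v. g (J2 u) v = - g u (J2 v)" "\<And>u v. g (J3 u) v = - g u (J3 v)"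
  shows "trace_on UNIV (\<lambda>z. pq_curvature e1 e2 e3 g J1 J2 J3 z u v) = (real DIM('e) / 4 + 2) * g u v"
proof -
  have bil: "bilinear g" and sym: "\<And>u v. g u v = g v u" and nd: "nondegenerate_on g UNIV"
    using g unfolding scalar_product_def nondegenerate_on_def by auto
  note D = pq_tripleD[OF J]
  have lin: "linear (\<lambda>v. g v w)" for w using bil unfolding bilinear_def by blast
  have linJ: "linear (\<lambda>v. g (K v) w)" if "linear K" for K w
    using linear_compose[OF that lin] by (simp add: o_def)
  have tr1: "trace_on UNIV (\<lambda>z. g (K z) w *\<^sub>R a) = g (K a) w" if "linear K" for K w a
    using trace_on_rank_one[OF subspace_UNIV linJ[OF that]] by simp
  have tr0: "trace_on UNIV (\<lambda>z. g z w *\<^sub>R a) = g a w" for w a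
    using trace_on_rank_one[OF subspace_UNIV lin] by simp
  have sk0: "trace_on UNIV J1 = 0" "trace_on UNIV J2 = 0" "trace_on UNIV J3 = 0"
    by (rule trace_on_skew[OF bil sym nd subspace_UNIV]; simp add: sk D)+
  have gJJ: "g (J1 (J1 a)) b = e1 * g a b" "g (J2 (J2 a)) b = e2 * g a b" "g (J3 (J3 a)) b = e3 * g a b" for a b
    by (simp_all add: D bilinear_lmul[OF bil])
  have tadd: "trace_on UNIV (\<lambda>z. L z + L' z) = trace_on UNIV L + trace_on UNIV L'" for L L' :: "'e \<Rightarrow> 'e"
    by (rule trace_on_add) simp_all
  have tscale: "trace_on UNIV (\<lambda>z. r *\<^sub>R L z) = r * trace_on UNIV L" for r and L :: "'e \<Rightarrow> 'e"
    by (rule trace_on_scale) simp_all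
  have eq: "(\<lambda>z. pq_curvature e1 e2 e3 g J1 J2 J3 z u v) = (\<lambda>z.
     (e1/2) *\<^sub>R (g (J1 z) u *\<^sub>R J1 v) + ((e2/2) *\<^sub>R (g (J2 z) u *\<^sub>R J2 v) + ((e3/2) *\<^sub>R (g (J3 z) u *\<^sub>R J3 v)
     + ((1/4 * g u v) *\<^sub>R z + ((-1/4) *\<^sub>R (g z v *\<^sub>R u)
     + ((- e1/4 * g (J1 u) v) *\<^sub>R J1 z + ((e1/4) *\<^sub>R (g (J1 z) v *\<^sub>R J1 u)
     + ((- e2/4 * g (J2 u) v) *\<^sub>R J2 z + ((e2/4) *\<^sub>R (g (J2 z) v *\<^sub>R J2 u)
     + ((- e3/4 * g (J3 u) v) *\<^sub>R J3 z + (e3/4) *\<^sub>R (g (J3 z) v *\<^sub>R J3 u)))))))))))"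
    by (simp add: pq_curvature_def wedge_def algebra_simps)
  have "trace_on UNIV (\<lambda>z. pq_curvature e1 e2 e3 g J1 J2 J3 z u v) =
     (e1/2) * (e1 * g v u) + ((e2/2) * (e2 * g v u) + ((e3/2) * (e3 * g v u)
     + ((1/4 * g u v) * real DIM('e) + ((-1/4) * g u v + ((e1/4) * (e1 * g u v)
     + ((e2/4) * (e2 * g u v) + (e3/4) * (e3 * g u v)))))))"
    by (simp only: eq tadd tscale) (simp add: tr0 tr1 D(1-3) sk0 trace_on_id gJJ)
  also have "\<dots> = (real DIM('e) / 4 + 2) * g u v"
    using D(4-6) sym[of v u] by algebra
  finally show ?thesis .
qed

section \<open>Curvature along a totally complex subspace\<close>

lemma tan_part_eq_self:
  assumes "bilinear g" "nondegenerate_on g W" "subspace W" "v \<in> W"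
  shows "tan_part g W v = v"
  unfolding tan_part_def
proof (rule the_equality)
  fix w assume "w \<in> W \<and> v - w \<in> orth_complement g W"
  then have "v - w = 0" using assms(2) subspace_diff[OF assms(3,4), of w]
    unfolding nondegenerate_on_def orth_complement_def by blast
  then show "w = v" by simp
qed (use assms in \<open>auto simp: orth_complement_def bilinear_lzero\<close>)

lemma tan_part_eq_0:
  assumes "bilinear g" "nondegenerate_on g W" "subspace W" "v \<in> orth_complement g W"
  shows "tan_part g W v = 0"
  unfolding tan_part_def
proof (rule the_equality)
  fix w assume w: "w \<in> W \<and> v - w \<in> orth_complement g W"
  have "g w z = 0" if "z \<in> W" for z
    using w assms(4) that bilinear_lsub[OF assms(1), of v w z] unfolding orth_complement_def by simp
  then show "w = 0" using assms(2) w unfolding nondegenerate_on_def by blast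
qed (use assms in \<open>auto simp: subspace_0\<close>)

lemma subspace_orth_complement: "bilinear g \<Longrightarrow> subspace (orth_complement g W)"
  unfolding subspace_def orth_complement_def by (auto simp: bilinear_lzero bilinear_ladd bilinear_lmul)

text \<open>All four assertions reduce to the position of the images of \<open>T\<close> and \<open>N\<close>: \<open>J\<^sub>1\<close> preserves both, \<open>J\<^sub>2\<close> and
\<open>J\<^sub>3\<close> send \<open>T\<close> to \<open>N\<close>. The image \<open>R X Y Z\<close> then lies in \<open>T\<close> for \<open>Z\<close> in \<open>T\<close> and in \<open>N\<close> for \<open>Z\<close> in \<open>N\<close>,
so that the projections are trivial.\<close>

lemma totally_complex_curvature:
  fixes g :: "'e::euclidean_space \<Rightarrow> 'e \<Rightarrow> real"
  assumes \<epsilon>: "\<epsilon> \<in> {-1, 1}" and g: "scalar_product g" and J: "pq_triple \<epsilon> 1 (- \<epsilon>) J1 J2 J3"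
    and sk: "\<And>u v. g (J1 u) v = - g u (J1 v)" "\<And>u v. g (J2 u) v = - g u (J2 v)"
    and T: "subspace T" "nondegenerate_on g T" "dim T = 2 * n" "J1 ` T = T"
    and J2: "\<And>X. X \<in> T \<Longrightarrow> J2 X \<in> orth_complement g T"
    and R: "\<And>X Y Z. R X Y Z = \<nu> *\<^sub>R pq_curvature \<epsilon> 1 (- \<epsilon>) g J1 J2 J3 X Y Z"
    and XY: "X \<in> T" "Y \<in> T"
  defines "N \<equiv> orth_complement g T"
  shows "(\<forall>Z\<in>T. tan_part g T (R X Y Z) = - (\<epsilon> * \<nu>) *\<^sub>R R_CP \<epsilon> g J1 X Y Z \<and>
            - (\<epsilon> * \<nu>) *\<^sub>R R_CP \<epsilon> g J1 X Y Z =
              (\<epsilon> * \<nu> / 4) *\<^sub>R (\<epsilon> *\<^sub>R wedge g X Y Z - wedge g (J1 X) (J1 Y) Z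
                               + (2 * g (J1 X) Y) *\<^sub>R J1 Z)) \<and>
         trace_on T (\<lambda>Z. tan_part g T (R Z X Y)) = \<nu> / 2 * (real n + 1) * g X Y \<and>
         (\<forall>Z\<in>T. nor_part g T (R X Y Z) = 0) \<and>
         (\<forall>Z\<in>N. tan_part g T (R X Y Z) = 0) \<and>
         (\<forall>Z\<in>N. nor_part g T (R X Y Z) =
            (\<nu> / 4) *\<^sub>R (- wedge g (J2 X) (J2 Y) Z + \<epsilon> *\<^sub>R wedge g (J3 X) (J3 Y) Z
                         + (2 * \<epsilon> * g (J1 X) Y) *\<^sub>R J1 Z))"
proof -
  have bil: "bilinear g" and sym: "\<And>u v. g u v = g v u"
    using g unfolding scalar_product_def by auto
  have \<epsilon>\<epsilon>: "\<epsilon> * \<epsilon> = 1" using \<epsilon> by auto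
  note D = pq_tripleD[OF J]
  have JT: "J1 u \<in> T" if "u \<in> T" for u using T(4) that by blast
  have orth: "g u v = 0" if "u \<in> N" "v \<in> T" for u v
    using that unfolding N_def orth_complement_def by blast
  have JN: "J1 u \<in> N" if "u \<in> N" for u
    unfolding N_def orth_complement_def using orth[OF that JT] sk(1) by simp
  have J2N: "J2 u \<in> N" if "u \<in> T" for u using J2[OF that] unfolding N_def .
  have J3N: "J3 u \<in> N" if "u \<in> T" for u using JN[OF J2N[OF that]] D(10) by simp
  have subN: "subspace N" unfolding N_def by (rule subspace_orth_complement[OF bil])
  have g0: "g (J2 u) v = 0" "g v (J2 u) = 0" "g (J3 u) v = 0" "g v (J3 u) = 0" if "u \<in> T" "v \<in> T" for u v
    using orth[OF J2N[OF that(1)] that(2)] orth[OF J3N[OF that(1)] that(2)] sym by metis+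
  have RT: "R a b c = (\<epsilon> * \<nu> / 4) *\<^sub>R (\<epsilon> *\<^sub>R wedge g a b c - wedge g (J1 a) (J1 b) c + (2 * g (J1 a) b) *\<^sub>R J1 c)"
    if abc: "a \<in> T" "b \<in> T" "c \<in> T" for a b c
  proof -
    have "R a b c = \<nu> *\<^sub>R ((1/2) *\<^sub>R (\<epsilon> * g (J1 a) b) *\<^sub>R J1 c + (1/4) *\<^sub>R (wedge g a b c - \<epsilon> *\<^sub>R wedge g (J1 a) (J1 b) c))"
      unfolding R pq_curvature_def wedge_def by (simp add: g0 abc)
    also have "wedge g a b c = \<epsilon> *\<^sub>R \<epsilon> *\<^sub>R wedge g a b c" using \<epsilon>\<epsilon> by simp
    finally show ?thesis by (simp add: algebra_simps)
  qed
  have RinT: "R a b c \<in> T" if "a \<in> T" "b \<in> T" "c \<in> T" for a b c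
    unfolding RT[OF that] wedge_def using that
    by (intro subspace_scale[OF T(1)] subspace_add[OF T(1)] subspace_diff[OF T(1)] JT)
  have tanT: "tan_part g T (R a b c) = R a b c" if "a \<in> T" "b \<in> T" "c \<in> T" for a b c
    by (rule tan_part_eq_self[OF bil T(2,1) RinT[OF that]])
  have RN: "R X Y Z = (\<nu> / 4) *\<^sub>R (- wedge g (J2 X) (J2 Y) Z + \<epsilon> *\<^sub>R wedge g (J3 X) (J3 Y) Z
                         + (2 * \<epsilon> * g (J1 X) Y) *\<^sub>R J1 Z)" if Z: "Z \<in> N" for Z
  proof -
    have "g X Z = 0" "g Y Z = 0" "g (J1 X) Z = 0" "g (J1 Y) Z = 0"
      using orth[OF Z] sym XY JT by metis+
    then show ?thesis
      unfolding R pq_curvature_def wedge_def by (simp add: g0 XY algebra_simps)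
  qed
  have RinN: "R X Y Z \<in> N" if "Z \<in> N" for Z
    unfolding RN[OF that] wedge_def using that XY
    by (intro subspace_scale[OF subN] subspace_add[OF subN] subspace_diff[OF subN] subspace_neg[OF subN] JN J2N J3N)
  have tanN: "tan_part g T (R X Y Z) = 0" if "Z \<in> N" for Z
    by (rule tan_part_eq_0[OF bil T(2,1) RinN[OF that, unfolded N_def]])
  have ric: "trace_on T (\<lambda>Z. tan_part g T (R Z X Y)) = \<nu> / 2 * (real n + 1) * g X Y"
  proof -
    have lin: "linear (\<lambda>v. g v w)" for w using bil unfolding bilinear_def by blast
    have linJ: "linear (\<lambda>v. g (J1 v) w)" for w
      using linear_compose[OF D(1) lin] by (simp add: o_def)
    note mem = subspace_scale[OF T(1)] subspace_add[OF T(1)] JT XY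
    \<comment> \<open>The Ricci endomorphism as a multiple of the identity, a multiple of \<open>J1\<close>, and rank-one maps.\<close>
    let ?f = "\<lambda>Z. (\<nu> / 4 * g X Y) *\<^sub>R Z" and ?g = "\<lambda>Z. (- \<nu> / 4) *\<^sub>R (g Z Y *\<^sub>R X)"
      and ?h = "\<lambda>Z. (- \<epsilon> * \<nu> / 4 * g (J1 X) Y) *\<^sub>R J1 Z" and ?i = "\<lambda>Z. (\<epsilon> * \<nu> / 4) *\<^sub>R (g (J1 Z) Y *\<^sub>R J1 X)"
      and ?j = "\<lambda>Z. (\<epsilon> * \<nu> / 2) *\<^sub>R (g (J1 Z) X *\<^sub>R J1 Y)"
    have "trace_on T (\<lambda>Z. tan_part g T (R Z X Y)) = trace_on T (\<lambda>Z. ?f Z + (?g Z + (?h Z + (?i Z + ?j Z))))"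
    proof (rule trace_on_cong[OF T(1)])
      fix Z assume Z: "Z \<in> T"
      have "R Z X Y = \<nu> *\<^sub>R ((1/2) *\<^sub>R (\<epsilon> * g (J1 Z) X) *\<^sub>R J1 Y + (1/4) *\<^sub>R (wedge g Z X Y - \<epsilon> *\<^sub>R wedge g (J1 Z) (J1 X) Y))"
        unfolding R pq_curvature_def wedge_def by (simp add: g0 XY Z)
      then show "tan_part g T (R Z X Y) = ?f Z + (?g Z + (?h Z + (?i Z + ?j Z)))"
        unfolding tanT[OF Z XY] wedge_def by (simp add: algebra_simps)
    qed
    also have "\<dots> = trace_on T ?f + (trace_on T ?g + (trace_on T ?h + (trace_on T ?i + trace_on T ?j)))"
      by (simp only: trace_on_add[OF T(1)] mem)
    also have "trace_on T ?f = \<nu> / 4 * g X Y * (2 * real n)"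
      using T by (simp add: trace_on_scale trace_on_id)
    also have "trace_on T ?g = - \<nu> / 4 * g X Y"
      by (subst trace_on_scale) (auto intro!: T(1) mem simp: trace_on_rank_one[OF T(1) lin XY(1)])
    also have "trace_on T ?h = 0"
      by (subst trace_on_scale) (auto intro!: T(1) mem simp: trace_on_skew[OF bil sym T(2,1) D(1) JT sk(1)])
    also have "trace_on T ?i = \<epsilon> * \<nu> / 4 * (\<epsilon> * g X Y)"
      by (subst trace_on_scale)
         (auto intro!: T(1) mem simp: trace_on_rank_one[OF T(1) linJ JT[OF XY(1)]] D(7) bilinear_lmul[OF bil])
    also have "trace_on T ?j = \<epsilon> * \<nu> / 2 * (\<epsilon> * g Y X)"
      by (subst trace_on_scale)
         (auto intro!: T(1) mem simp: trace_on_rank_one[OF T(1) linJ JT[OF XY(2)]] D(7) bilinear_lmul[OF bil])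
    finally show ?thesis using sym[of Y X] \<epsilon>\<epsilon> by algebra
  qed
  have CP: "- (\<epsilon> * \<nu>) *\<^sub>R R_CP \<epsilon> g J1 X Y Z =
              (\<epsilon> * \<nu> / 4) *\<^sub>R (\<epsilon> *\<^sub>R wedge g X Y Z - wedge g (J1 X) (J1 Y) Z
                               + (2 * g (J1 X) Y) *\<^sub>R J1 Z)" for Z
    by (simp add: R_CP_def algebra_simps)
  show ?thesis
  proof (intro conjI ballI)
    fix Z assume Z: "Z \<in> T"
    show "tan_part g T (R X Y Z) = - (\<epsilon> * \<nu>) *\<^sub>R R_CP \<epsilon> g J1 X Y Z"
      unfolding tanT[OF XY Z] CP by (rule RT[OF XY Z])
    show "nor_part g T (R X Y Z) = 0" unfolding nor_part_def tanT[OF XY Z] by simp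
  next
    fix Z assume Z: "Z \<in> N"
    show "nor_part g T (R X Y Z) = (\<nu> / 4) *\<^sub>R (- wedge g (J2 X) (J2 Y) Z + \<epsilon> *\<^sub>R wedge g (J3 X) (J3 Y) Z
                         + (2 * \<epsilon> * g (J1 X) Y) *\<^sub>R J1 Z)"
      unfolding nor_part_def tanN[OF Z] using RN[OF Z] by simp
  qed (rule CP ric tanN; assumption?)+
qed

section \<open>Symmetry of second derivatives and product rules\<close>

text \<open>By the mean value theorem in the direction \<open>a\<close>, the second difference is \<open>t\<close> times a difference of the
values of \<open>D _ a\<close> at two points at distance \<open>O(t)\<close> from \<open>x\<close>; differentiability of \<open>D _ a\<close> at the single
point \<open>x\<close> evaluates it up to \<open>o(t)\<close>.\<close>

lemma second_difference_approx:
  fixes f :: "'e::euclidean_space \<Rightarrow> real"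
  assumes U: "open U" "x \<in> U"
    and f: "\<And>y. y \<in> U \<Longrightarrow> (f has_derivative D y) (at y)"
    and D: "((\<lambda>y. D y a) has_derivative D') (at x)"
    and e: "e > 0"
  shows "\<exists>d>0. \<forall>t. 0 < t \<and> t < d \<longrightarrow>
    \<bar>f (x + t *\<^sub>R a + t *\<^sub>R b) - f (x + t *\<^sub>R a) - f (x + t *\<^sub>R b) + f x - t\<^sup>2 * D' b\<bar> \<le> e * t\<^sup>2"
proof -
  \<comment> \<open>All points involved lie within \<open>t * M\<close> of \<open>x\<close>; the summand 1 keeps \<open>M\<close> positive.\<close>
  define M where "M = norm a + norm b + 1"
  have M: "M > 0" by (simp add: M_def add_nonneg_pos)
  obtain r where r: "r > 0" "ball x r \<subseteq> U" using U open_contains_ball by blast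
  have lin: "linear D'" using D has_derivative_linear by blast
  obtain d0 where d0: "d0 > 0" and
    d0': "\<And>y. norm (y - x) < d0 \<Longrightarrow> norm (D y a - D x a - D' (y - x)) \<le> (e / (2 * M)) * norm (y - x)"
    using D e M unfolding has_derivative_at_alt
    by (metis divide_pos_pos mult_pos_pos zero_less_numeral)
  define d where "d = min r d0 / M"
  have d: "d > 0" using r d0 M by (simp add: d_def)
  have "\<bar>f (x + t *\<^sub>R a + t *\<^sub>R b) - f (x + t *\<^sub>R a) - f (x + t *\<^sub>R b) + f x - t\<^sup>2 * D' b\<bar> \<le> e * t\<^sup>2"
    if t: "0 < t" "t < d" for t
  proof -
    have tM: "t * M < r" "t * M < d0" using t M by (auto simp: d_def field_simps)
    have small: "norm (s *\<^sub>R a + q *\<^sub>R b) \<le> t * M" if "0 \<le> s" "s \<le> t" "0 \<le> q" "q \<le> t" for s q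
    proof -
      have "norm (s *\<^sub>R a + q *\<^sub>R b) \<le> s * norm a + q * norm b"
        using norm_triangle_ineq[of "s *\<^sub>R a" "q *\<^sub>R b"] that by simp
      also have "\<dots> \<le> t * norm a + t * norm b" using that by (intro add_mono mult_right_mono) auto
      also have "\<dots> \<le> t * M" using t by (simp add: M_def algebra_simps)
      finally show ?thesis .
    qed
    have inU: "x + s *\<^sub>R a + q *\<^sub>R b \<in> U" if "0 \<le> s" "s \<le> t" "0 \<le> q" "q \<le> t" for s q
    proof -
      have "dist x (x + s *\<^sub>R a + q *\<^sub>R b) = norm (s *\<^sub>R a + q *\<^sub>R b)"
        by (metis add.assoc add_diff_cancel_left' dist_norm norm_minus_commute)
      then show ?thesis using small[OF that] tM(1) r(2) by (auto simp: subset_eq)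
    qed
    define h where "h s = f (x + s *\<^sub>R a + t *\<^sub>R b) - f (x + s *\<^sub>R a)" for s
    define h' where "h' s = D (x + s *\<^sub>R a + t *\<^sub>R b) a - D (x + s *\<^sub>R a) a" for s
    have dh: "(h has_real_derivative h' s) (at s)" if "0 \<le> s" "s \<le> t" for s
    proof -
      have 1: "x + s *\<^sub>R a + t *\<^sub>R b \<in> U" using inU[of s t] that t by simp
      have 2: "x + s *\<^sub>R a \<in> U" using inU[of s 0] that t by simp
      have l1: "linear (D (x + s *\<^sub>R a + t *\<^sub>R b))" "linear (D (x + s *\<^sub>R a))"
        using f[OF 1] f[OF 2] has_derivative_linear by blast+
      have "((\<lambda>s. f (x + s *\<^sub>R a + t *\<^sub>R b)) has_derivative (\<lambda>q. D (x + s *\<^sub>R a + t *\<^sub>R b) (q *\<^sub>R a))) (at s)"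
        by (rule has_derivative_compose[where f = "\<lambda>s. x + s *\<^sub>R a + t *\<^sub>R b" and g = f, OF _ f[OF 1]])
           (auto intro!: derivative_eq_intros)
      moreover have "((\<lambda>s. f (x + s *\<^sub>R a)) has_derivative (\<lambda>q. D (x + s *\<^sub>R a) (q *\<^sub>R a))) (at s)"
        by (rule has_derivative_compose[where f = "\<lambda>s. x + s *\<^sub>R a" and g = f, OF _ f[OF 2]])
           (auto intro!: derivative_eq_intros)
      ultimately have "(h has_derivative (\<lambda>q. D (x + s *\<^sub>R a + t *\<^sub>R b) (q *\<^sub>R a) - D (x + s *\<^sub>R a) (q *\<^sub>R a))) (at s)"
        unfolding h_def by (rule has_derivative_diff)
      moreover have "(\<lambda>q. D (x + s *\<^sub>R a + t *\<^sub>R b) (q *\<^sub>R a) - D (x + s *\<^sub>R a) (q *\<^sub>R a)) = (*) (h' s)"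
        using l1 by (auto simp: h'_def linear_cmul algebra_simps)
      ultimately show ?thesis by (simp add: has_field_derivative_def)
    qed
    obtain z where z: "0 < z" "z < t" "h t - h 0 = (t - 0) * h' z"
      using MVT2[of 0 t h h'] t dh by auto
    define p q where "p = z *\<^sub>R a + t *\<^sub>R b" and "q = z *\<^sub>R a"
    have np: "norm p \<le> t * M" "norm q \<le> t * M" using small[of z t] small[of z 0] z t by (auto simp: p_def q_def)
    have bound: "\<bar>D (x + w) a - D x a - D' w\<bar> \<le> (e / 2) * t" if "norm w \<le> t * M" for w
    proof -
      have "\<bar>D (x + w) a - D x a - D' w\<bar> \<le> (e / (2 * M)) * norm w"
        using d0'[of "x + w"] that tM by simp
      also have "\<dots> \<le> (e / (2 * M)) * (t * M)" using that e M by (intro mult_left_mono) auto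
      finally show ?thesis using M by simp
    qed
    have "D' p - D' q = t * D' b" using lin by (simp add: p_def q_def linear_add linear_cmul)
    moreover have "h' z = D (x + p) a - D (x + q) a" by (simp add: h'_def p_def q_def add.assoc)
    ultimately have "\<bar>h' z - t * D' b\<bar> \<le> e * t"
      using bound[OF np(1)] bound[OF np(2)] by linarith
    then have "t * \<bar>h' z - t * D' b\<bar> \<le> t * (e * t)" using t by (intro mult_left_mono) auto
    have eq: "f (x + t *\<^sub>R a + t *\<^sub>R b) - f (x + t *\<^sub>R a) - f (x + t *\<^sub>R b) + f x - t\<^sup>2 * D' b
        = t * (h' z - t * D' b)"
      using z(3) by (simp add: h_def algebra_simps power2_eq_square)
    have "t * (e * t) = e * t\<^sup>2" by (simp add: power2_eq_square)
    with \<open>t * \<bar>h' z - t * D' b\<bar> \<le> t * (e * t)\<close> show ?thesis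
      unfolding eq abs_mult using t by simp
  qed
  then show ?thesis using d by blast
qed

text \<open>The second difference is symmetric in \<open>a\<close> and \<open>b\<close>, so both mixed derivatives are limits of the same
difference quotient.\<close>

lemma symmetric_second_derivative_real:
  fixes f :: "'e::euclidean_space \<Rightarrow> real"
  assumes U: "open U" "x \<in> U"
    and f: "\<And>y. y \<in> U \<Longrightarrow> (f has_derivative D y) (at y)"
    and a: "((\<lambda>y. D y a) has_derivative Da) (at x)"
    and b: "((\<lambda>y. D y b) has_derivative Db) (at x)"
  shows "Da b = Db a"
proof -
  have "\<bar>Da b - Db a\<bar> \<le> 0 + e" if "e > 0" for e
  proof -
    have e2: "e / 2 > 0" using that by simp
    obtain d1 where d1: "d1 > 0" "\<And>t. 0 < t \<Longrightarrow> t < d1 \<Longrightarrow>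
      \<bar>f (x + t *\<^sub>R a + t *\<^sub>R b) - f (x + t *\<^sub>R a) - f (x + t *\<^sub>R b) + f x - t\<^sup>2 * Da b\<bar> \<le> (e / 2) * t\<^sup>2"
      using second_difference_approx[OF U f a e2, of b] by blast
    obtain d2 where d2: "d2 > 0" "\<And>t. 0 < t \<Longrightarrow> t < d2 \<Longrightarrow>
      \<bar>f (x + t *\<^sub>R b + t *\<^sub>R a) - f (x + t *\<^sub>R b) - f (x + t *\<^sub>R a) + f x - t\<^sup>2 * Db a\<bar> \<le> (e / 2) * t\<^sup>2"
      using second_difference_approx[OF U f b e2, of a] by blast
    define t where "t = min d1 d2 / 2"
    have t: "0 < t" "t < d1" "t < d2" using d1(1) d2(1) by (auto simp: t_def)
    have c: "x + t *\<^sub>R b + t *\<^sub>R a = x + t *\<^sub>R a + t *\<^sub>R b" by (simp add: algebra_simps)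
    have "\<bar>t\<^sup>2 * Da b - t\<^sup>2 * Db a\<bar> \<le> e * t\<^sup>2"
      using d1(2)[OF t(1,2)] d2(2)[OF t(1,3)] unfolding c by linarith
    then have "t\<^sup>2 * \<bar>Da b - Db a\<bar> \<le> t\<^sup>2 * e"
      unfolding right_diff_distrib[symmetric] abs_mult by (simp add: mult.commute)
    then show ?thesis using t by simp
  qed
  then have "\<bar>Da b - Db a\<bar> \<le> 0" by (rule field_le_epsilon)
  then show ?thesis by simp
qed

lemma symmetric_second_derivative:
  fixes f :: "'e::euclidean_space \<Rightarrow> 'b::euclidean_space"
  assumes U: "open U" "x \<in> U"
    and f: "\<And>y. y \<in> U \<Longrightarrow> (f has_derivative D y) (at y)"
    and a: "((\<lambda>y. D y a) has_derivative Da) (at x)"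
    and b: "((\<lambda>y. D y b) has_derivative Db) (at x)"
  shows "Da b = Db a"
proof (rule euclidean_eqI)
  fix i :: 'b
  show "Da b \<bullet> i = Db a \<bullet> i"
    by (rule symmetric_second_derivative_real[OF U, of "\<lambda>y. f y \<bullet> i" "\<lambda>y v. D y v \<bullet> i"])
       (intro has_derivative_inner_left f a b; assumption)+
qed

lemma bilinear_expand:
  fixes F :: "'a::euclidean_space \<Rightarrow> 'b::euclidean_space \<Rightarrow> 'c::real_vector"
  assumes "bilinear F"
  shows "F u v = (\<Sum>i\<in>Basis. \<Sum>j\<in>Basis. ((u \<bullet> i) * (v \<bullet> j)) *\<^sub>R F i j)"
proof -
  have "F u v = F (\<Sum>i\<in>Basis. (u \<bullet> i) *\<^sub>R i) (\<Sum>j\<in>Basis. (v \<bullet> j) *\<^sub>R j)"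
    by (simp add: euclidean_representation)
  also have "\<dots> = (\<Sum>(i,j)\<in>Basis \<times> Basis. F ((u \<bullet> i) *\<^sub>R i) ((v \<bullet> j) *\<^sub>R j))"
    by (rule bilinear_sum[OF assms])
  also have "\<dots> = (\<Sum>i\<in>Basis. \<Sum>j\<in>Basis. ((u \<bullet> i) * (v \<bullet> j)) *\<^sub>R F i j)"
    by (simp add: sum.cartesian_product bilinear_lmul[OF assms] bilinear_rmul[OF assms] split_def mult.commute)
  finally show ?thesis .
qed

text \<open>The product rule for a bilinear form that depends on a point, evaluated on vector fields along \<open>\<phi>\<close>. Only
the components \<open>F y u v\<close> with constant \<open>u\<close>, \<open>v\<close> are required to be differentiable, which is how
differentiability of metrics and connections in coordinates is available; an expansion in the standard
bases reduces the general case to this one.\<close>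

lemma bilinear_field_has_derivative:
  fixes F :: "'x::euclidean_space \<Rightarrow> 'a::euclidean_space \<Rightarrow> 'b::euclidean_space \<Rightarrow> 'c::real_normed_vector"
    and \<phi> :: "'y::euclidean_space \<Rightarrow> 'x"
  assumes V: "open V" "\<phi> x \<in> V" and bil: "\<And>y. y \<in> V \<Longrightarrow> bilinear (F y)"
    and F: "\<And>u v. ((\<lambda>y. F y u v) has_derivative DF u v) (at (\<phi> x))"
    and \<phi>: "(\<phi> has_derivative \<phi>') (at x)"
    and a: "(a has_derivative a') (at x)" and b: "(b has_derivative b') (at x)"
  shows "((\<lambda>y. F (\<phi> y) (a y) (b y)) has_derivative
    (\<lambda>z. DF (a x) (b x) (\<phi>' z) + F (\<phi> x) (a' z) (b x) + F (\<phi> x) (a x) (b' z))) (at x)"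
proof -
  let ?S = "\<lambda>F u v. \<Sum>i\<in>Basis. \<Sum>j\<in>Basis. ((u \<bullet> i) * (v \<bullet> j)) *\<^sub>R F i j :: 'c"
  have cont: "continuous (at x) \<phi>" using \<phi> has_derivative_continuous by blast
  have ev: "\<forall>\<^sub>F y in at x. \<phi> y \<in> V"
    using cont V by (metis continuous_at_imp_continuous_at_within isCont_def tendsto_def topological_tendstoD)
  have DF: "DF u v z = ?S (\<lambda>i j. DF i j z) u v" for u v z
  proof -
    have 1: "((\<lambda>y. ?S (F y) u v) has_derivative (\<lambda>z. ?S (\<lambda>i j. DF i j z) u v)) (at (\<phi> x))"
      by (intro has_derivative_sum has_derivative_scaleR_right F)
    have "((\<lambda>y. F y u v) has_derivative (\<lambda>z. ?S (\<lambda>i j. DF i j z) u v)) (at (\<phi> x))"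
      by (rule has_derivative_transform_within_open[OF 1 V]) (simp add: bilinear_expand[OF bil, symmetric])
    then show ?thesis by (rule fun_cong[OF has_derivative_unique[OF F]])
  qed
  have comp: "((\<lambda>y. F (\<phi> y) i j) has_derivative (\<lambda>z. DF i j (\<phi>' z))) (at x)" for i j
    by (rule has_derivative_compose[where f = \<phi> and g = "\<lambda>y. F y i j" and g' = "DF i j", OF \<phi> F])
  have 1: "((\<lambda>y. ?S (F (\<phi> y)) (a y) (b y)) has_derivative
    (\<lambda>z. \<Sum>i\<in>Basis. \<Sum>j\<in>Basis. ((a x \<bullet> i) * (b x \<bullet> j)) *\<^sub>R DF i j (\<phi>' z)
       + ((a x \<bullet> i) * (b' z \<bullet> j) + (a' z \<bullet> i) * (b x \<bullet> j)) *\<^sub>R F (\<phi> x) i j)) (at x)"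
    by (rule has_derivative_sum, rule has_derivative_sum, rule has_derivative_scaleR[OF _ comp],
        rule has_derivative_mult; rule has_derivative_inner_left, rule a b)
  have 2: "(\<lambda>z. \<Sum>i\<in>Basis. \<Sum>j\<in>Basis. ((a x \<bullet> i) * (b x \<bullet> j)) *\<^sub>R DF i j (\<phi>' z)
       + ((a x \<bullet> i) * (b' z \<bullet> j) + (a' z \<bullet> i) * (b x \<bullet> j)) *\<^sub>R F (\<phi> x) i j) =
     (\<lambda>z. DF (a x) (b x) (\<phi>' z) + F (\<phi> x) (a' z) (b x) + F (\<phi> x) (a x) (b' z))"
    by (rule ext, subst DF, subst (1 2) bilinear_expand[OF bil[OF V(2)]])
       (simp add: sum.distrib scaleR_add_left algebra_simps)
  show ?thesis
    unfolding 2[symmetric]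
  proof (rule has_derivative_transform_eventually[OF 1])
    show "\<forall>\<^sub>F y in at x. ?S (F (\<phi> y)) (a y) (b y) = F (\<phi> y) (a y) (b y)"
      using ev by eventually_elim (simp add: bilinear_expand[OF bil, symmetric])
  qed (use V in \<open>simp_all add: bilinear_expand[OF bil, symmetric]\<close>)
qed

lemma linear_field_has_derivative:
  fixes F :: "'y::euclidean_space \<Rightarrow> 'a::euclidean_space \<Rightarrow> 'c::real_normed_vector"
  assumes V: "open V" "x \<in> V" and lin: "\<And>y. y \<in> V \<Longrightarrow> linear (F y)"
    and F: "\<And>u. ((\<lambda>y. F y u) has_derivative DF u) (at x)"
    and a: "(a has_derivative a') (at x)"
  shows "((\<lambda>y. F y (a y)) has_derivative (\<lambda>z. DF (a x) z + F x (a' z))) (at x)"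
proof -
  have bil: "bilinear (\<lambda>u (r::real). r *\<^sub>R F y u)" if "y \<in> V" for y
    using lin[OF that] unfolding bilinear_def
    by (auto intro!: linearI simp: linear_add linear_cmul algebra_simps)
  have F': "((\<lambda>y. r *\<^sub>R F y u) has_derivative (\<lambda>z. r *\<^sub>R DF u z)) (at x)" for u and r :: real
    by (intro has_derivative_scaleR_right F)
  \<comment> \<open>The bilinear rule, with scalar multiplication as the second slot.\<close>
  have "((\<lambda>y. 1 *\<^sub>R F y (a y)) has_derivative
      (\<lambda>z. (1::real) *\<^sub>R DF (a x) z + 1 *\<^sub>R F x (a' z) + 0 *\<^sub>R F x (a x))) (at x)"
    by (rule bilinear_field_has_derivative[where F = "\<lambda>y u r. r *\<^sub>R F y u" and \<phi> = "\<lambda>y. y"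
          and V = V and DF = "\<lambda>u r z. r *\<^sub>R DF u z", OF V bil F' has_derivative_ident a has_derivative_const])
  then show ?thesis by simp
qed

section \<open>The curvature tensor under a change of coordinates\<close>

lemma smooth_on_differentiable:
  "smooth_on S f \<Longrightarrow> x \<in> S \<Longrightarrow> f differentiable (at x)"
  unfolding smooth_on_def by (metis cont_diff.simps(2))

lemma smooth_on_derivative:
  "smooth_on S f \<Longrightarrow> smooth_on S (\<lambda>x. frechet_derivative f (at x) v)"
  unfolding smooth_on_def by (metis cont_diff.simps(2))

lemma smooth_on_has_derivative:
  "smooth_on S f \<Longrightarrow> x \<in> S \<Longrightarrow> (f has_derivative frechet_derivative f (at x)) (at x)"
  using smooth_on_differentiable frechet_derivative_works by blast

lemma christoffel_eqI:
  assumes "scalar_product (g x)"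
    and "\<And>z. 2 * g x w z = dd (\<lambda>y. g y v z) x u + dd (\<lambda>y. g y u z) x v - dd (\<lambda>y. g y u v) x z"
  shows "christoffel g x u v = w"
  unfolding christoffel_def
proof (rule the_equality)
  fix w' assume "\<forall>z. 2 * g x w' z = dd (\<lambda>y. g y v z) x u + dd (\<lambda>y. g y u z) x v - dd (\<lambda>y. g y u v) x z"
  then have "2 * g x w' z = 2 * g x w z" for z using assms(2) by metis
  then show "w' = w" using scalar_product_eqI[OF assms(1)] by (simp add: mult_left_cancel)
qed (use assms in blast)

text \<open>A diffeomorphism \<open>\<phi>\<close> from \<open>U\<close> to \<open>V\<close> with \<open>g = \<phi>\<^sup>* G\<close>. A differentiable field \<open>\<Gamma>\<close> of Christoffel
symbols of \<open>G\<close> is part of the data. For the model metric it is known explicitly, and differentiability of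
the Christoffel symbols of \<open>g\<close> is then a consequence of the transformation law.\<close>

locale connection_pullback =
  fixes U V :: "'e::euclidean_space set" and \<phi> \<psi> :: "'e \<Rightarrow> 'e"
    and g G :: "'e \<Rightarrow> 'e \<Rightarrow> 'e \<Rightarrow> real" and \<Gamma> :: "'e \<Rightarrow> 'e \<Rightarrow> 'e \<Rightarrow> 'e"
  assumes open_U: "open U" and open_V: "open V"
    and maps: "\<And>y. y \<in> U \<Longrightarrow> \<phi> y \<in> V"
    and inv: "\<And>y. y \<in> U \<Longrightarrow> \<psi> (\<phi> y) = y" "\<And>z. z \<in> V \<Longrightarrow> \<phi> (\<psi> z) = z"
    and smooth: "smooth_on U \<phi>" "smooth_on V \<psi>"
    and pull: "\<And>y u v. y \<in> U \<Longrightarrow>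
       g y u v = G (\<phi> y) (frechet_derivative \<phi> (at y) u) (frechet_derivative \<phi> (at y) v)"
    and sp: "\<And>y. y \<in> U \<Longrightarrow> scalar_product (g y)" "\<And>z. z \<in> V \<Longrightarrow> scalar_product (G z)"
    and G_diff: "\<And>z u v. z \<in> V \<Longrightarrow> (\<lambda>z. G z u v) differentiable (at z)"
    and \<Gamma>_diff: "\<And>z u v. z \<in> V \<Longrightarrow> (\<lambda>z. \<Gamma> z u v) differentiable (at z)"
    and \<Gamma>_bil: "\<And>z. z \<in> V \<Longrightarrow> bilinear (\<Gamma> z)"
    and koszul: "\<And>z u v w. z \<in> V \<Longrightarrow> 2 * G z (\<Gamma> z u v) w =
       dd (\<lambda>y. G y v w) z u + dd (\<lambda>y. G y u w) z v - dd (\<lambda>y. G y u v) z w"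
begin

definition jac where "jac y = frechet_derivative \<phi> (at y)"
definition hess where "hess y w = frechet_derivative (\<lambda>y. jac y w) (at y)"

lemma jac_der: "y \<in> U \<Longrightarrow> (\<phi> has_derivative jac y) (at y)"
  unfolding jac_def using smooth(1) by (rule smooth_on_has_derivative)

lemma jac_lin: "y \<in> U \<Longrightarrow> linear (jac y)"
  using jac_der has_derivative_linear by blast

lemma smooth_jac: "smooth_on U (\<lambda>y. jac y w)"
  unfolding jac_def using smooth(1) by (rule smooth_on_derivative)

lemma hess_der: "y \<in> U \<Longrightarrow> ((\<lambda>y. jac y w) has_derivative hess y w) (at y)"
  unfolding hess_def using smooth_jac by (rule smooth_on_has_derivative)

lemma smooth_hess: "smooth_on U (\<lambda>y. hess y w v)"
  unfolding hess_def using smooth_jac by (rule smooth_on_derivative)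

lemma hess_sym: "y \<in> U \<Longrightarrow> hess y w v = hess y v w"
  using symmetric_second_derivative[OF open_U, of y \<phi> jac] jac_der hess_der by blast

lemma dhess_sym: "y \<in> U \<Longrightarrow> dd (\<lambda>y. hess y w v) y u = dd (\<lambda>y. hess y w u) y v"
  using symmetric_second_derivative[OF open_U, of y "\<lambda>y. jac y w" "\<lambda>y. hess y w"] hess_der
    smooth_on_has_derivative[OF smooth_hess] by blast

text \<open>The chain rule for both compositions makes the derivative of \<open>\<psi>\<close> a two-sided inverse of the Jacobian.\<close>

lemma inverse_der:
  assumes "y \<in> U"
  shows "frechet_derivative \<psi> (at (\<phi> y)) (jac y v) = v" "jac y (frechet_derivative \<psi> (at (\<phi> y)) v) = v"
proof -
  have \<psi>: "(\<psi> has_derivative frechet_derivative \<psi> (at (\<phi> y))) (at (\<phi> y))"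
    by (rule smooth_on_has_derivative[OF smooth(2) maps[OF assms]])
  have "((\<lambda>y. \<psi> (\<phi> y)) has_derivative (\<lambda>v. frechet_derivative \<psi> (at (\<phi> y)) (jac y v))) (at y)"
    by (rule has_derivative_compose[OF jac_der[OF assms] \<psi>])
  moreover have "((\<lambda>y. \<psi> (\<phi> y)) has_derivative (\<lambda>v. v)) (at y)"
    by (rule has_derivative_transform_within_open[OF has_derivative_ident open_U assms]) (simp add: inv)
  ultimately show "frechet_derivative \<psi> (at (\<phi> y)) (jac y v) = v" using has_derivative_unique by metis
  have "((\<lambda>z. \<phi> (\<psi> z)) has_derivative (\<lambda>v. jac y (frechet_derivative \<psi> (at (\<phi> y)) v))) (at (\<phi> y))"
    by (rule has_derivative_compose[OF \<psi>]) (simp add: inv assms jac_der)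
  moreover have "((\<lambda>z. \<phi> (\<psi> z)) has_derivative (\<lambda>v. v)) (at (\<phi> y))"
    by (rule has_derivative_transform_within_open[OF has_derivative_ident open_V maps[OF assms]]) (simp add: inv)
  ultimately show "jac y (frechet_derivative \<psi> (at (\<phi> y)) v) = v" using has_derivative_unique by metis
qed

lemma G_bil: "z \<in> V \<Longrightarrow> bilinear (G z)" and G_sym: "z \<in> V \<Longrightarrow> G z u v = G z v u"
  using sp(2) unfolding scalar_product_def by auto

lemma G_der: "z \<in> V \<Longrightarrow> ((\<lambda>z. G z u v) has_derivative dd (\<lambda>z. G z u v) z) (at z)"
  by (rule G_diff[unfolded frechet_derivative_works])

lemma \<Gamma>_der: "z \<in> V \<Longrightarrow> ((\<lambda>z. \<Gamma> z u v) has_derivative dd (\<lambda>z. \<Gamma> z u v) z) (at z)"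
  by (rule \<Gamma>_diff[unfolded frechet_derivative_works])

lemma g_der:
  assumes "y \<in> U"
  shows "dd (\<lambda>y. g y u v) y w =
    dd (\<lambda>z. G z (jac y u) (jac y v)) (\<phi> y) (jac y w) + G (\<phi> y) (hess y u w) (jac y v) + G (\<phi> y) (jac y u) (hess y v w)"
proof -
  have "((\<lambda>y. G (\<phi> y) (jac y u) (jac y v)) has_derivative (\<lambda>w.
    dd (\<lambda>z. G z (jac y u) (jac y v)) (\<phi> y) (jac y w) + G (\<phi> y) (hess y u w) (jac y v) + G (\<phi> y) (jac y u) (hess y v w))) (at y)"
    by (rule bilinear_field_has_derivative[OF open_V maps[OF assms] G_bil G_der[OF maps[OF assms]]
          jac_der[OF assms] hess_der[OF assms] hess_der[OF assms]])
  then have "((\<lambda>y. g y u v) has_derivative (\<lambda>w.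
    dd (\<lambda>z. G z (jac y u) (jac y v)) (\<phi> y) (jac y w) + G (\<phi> y) (hess y u w) (jac y v) + G (\<phi> y) (jac y u) (hess y v w))) (at y)"
    by (rule has_derivative_transform_within_open[OF _ open_U assms]) (simp add: pull jac_def)
  then show ?thesis by (rule fun_cong[OF frechet_derivative_at[symmetric]])
qed

text \<open>The transformation law of Christoffel symbols, in the form \<open>jac(\<nabla>\<^sub>u v) = \<partial>\<^sub>u(jac v) + \<Gamma>(jac u, jac v)\<close> for
constant \<open>v\<close>. In the Koszul formula for \<open>g\<close> the product rule produces six terms with second derivatives
of \<open>\<phi>\<close>; by their symmetry four cancel and the other two agree.\<close>

lemma christoffel_pullback:
  assumes "y \<in> U"
  shows "jac y (christoffel g y u v) = hess y v u + \<Gamma> (\<phi> y) (jac y u) (jac y v)"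
proof -
  let ?W = "hess y v u + \<Gamma> (\<phi> y) (jac y u) (jac y v)" and ?z = "\<phi> y"
  let ?w = "frechet_derivative \<psi> (at (\<phi> y)) ?W"
  have W: "jac y ?w = ?W" using inverse_der(2)[OF assms] .
  have z: "?z \<in> V" using maps assms by blast
  have "christoffel g y u v = ?w"
  proof (rule christoffel_eqI[where g = g, OF sp(1)[OF assms]])
    fix t
    have "2 * g y ?w t = 2 * G ?z (hess y v u) (jac y t) + 2 * G ?z (\<Gamma> ?z (jac y u) (jac y v)) (jac y t)"
      unfolding pull[OF assms] jac_def[symmetric] W by (simp add: bilinear_ladd[OF G_bil[OF z]])
    also have "\<dots> = dd (\<lambda>y. g y v t) y u + dd (\<lambda>y. g y u t) y v - dd (\<lambda>y. g y u v) y t"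
      unfolding koszul[OF z] g_der[OF assms]
      using hess_sym[OF assms, of u v] hess_sym[OF assms, of t u] hess_sym[OF assms, of t v]
        G_sym[OF z, of "jac y u" "hess y v t"] G_sym[OF z, of "jac y v" "hess y u t"]
      by simp
    finally show "2 * g y ?w t = dd (\<lambda>y. g y v t) y u + dd (\<lambda>y. g y u t) y v - dd (\<lambda>y. g y u v) y t" .
  qed
  then show ?thesis using W by simp
qed

lemma christoffel_model: "z \<in> V \<Longrightarrow> christoffel G z u v = \<Gamma> z u v"
  by (rule christoffel_eqI[OF sp(2)]) (use koszul in auto)

lemma christoffel_differentiable:
  assumes "y \<in> U"
  shows "(\<lambda>y. christoffel g y u v) differentiable (at y)"
proof -
  have 1: "((\<lambda>y. hess y v u + \<Gamma> (\<phi> y) (jac y u) (jac y v)) has_derivative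
     (\<lambda>w. dd (\<lambda>y. hess y v u) y w + (dd (\<lambda>z. \<Gamma> z (jac y u) (jac y v)) (\<phi> y) (jac y w)
       + \<Gamma> (\<phi> y) (hess y u w) (jac y v) + \<Gamma> (\<phi> y) (jac y u) (hess y v w)))) (at y)"
    by (intro has_derivative_add smooth_on_has_derivative[OF smooth_hess assms]
      bilinear_field_has_derivative[OF open_V maps[OF assms] \<Gamma>_bil \<Gamma>_der[OF maps[OF assms]] jac_der[OF assms] hess_der[OF assms] hess_der[OF assms]])
  have B': "((\<lambda>y. frechet_derivative \<psi> (at (\<phi> y)) u) has_derivative
      (\<lambda>v. dd (\<lambda>z. frechet_derivative \<psi> (at z) u) (\<phi> y) (jac y v))) (at y)" for u
    by (rule has_derivative_compose[OF jac_der[OF assms]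
          smooth_on_has_derivative[OF smooth_on_derivative[OF smooth(2)] maps[OF assms]]])
  have lin: "linear (frechet_derivative \<psi> (at (\<phi> y)))" if "y \<in> U" for y
    using smooth_on_differentiable[OF smooth(2) maps[OF that]] by (rule linear_frechet_derivative)
  have "(\<lambda>y. frechet_derivative \<psi> (at (\<phi> y)) (hess y v u + \<Gamma> (\<phi> y) (jac y u) (jac y v))) differentiable (at y)"
    using linear_field_has_derivative[OF open_U assms lin B' 1] unfolding differentiable_def by blast
  then obtain D where "((\<lambda>y. frechet_derivative \<psi> (at (\<phi> y)) (hess y v u + \<Gamma> (\<phi> y) (jac y u) (jac y v)))
     has_derivative D) (at y)" unfolding differentiable_def by blast
  then have "((\<lambda>y. christoffel g y u v) has_derivative D) (at y)"
    by (rule has_derivative_transform_within_open[OF _ open_U assms])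
       (metis christoffel_pullback inverse_der(1))
  then show ?thesis unfolding differentiable_def by blast
qed

text \<open>Both sides of \<open>christoffel_pullback\<close> are differentiated in the direction \<open>u\<close>.\<close>

lemma connection_derivative:
  assumes "y \<in> U"
  shows "jac y (dd (\<lambda>y. christoffel g y v w) y u) =
    dd (\<lambda>y. hess y w v) y u + dd (\<lambda>z. \<Gamma> z (jac y v) (jac y w)) (\<phi> y) (jac y u)
       + \<Gamma> (\<phi> y) (hess y v u) (jac y w) + \<Gamma> (\<phi> y) (jac y v) (hess y w u) - hess y (christoffel g y v w) u"
proof -
  have 1: "((\<lambda>y. hess y w v + \<Gamma> (\<phi> y) (jac y v) (jac y w)) has_derivative
     (\<lambda>u. dd (\<lambda>y. hess y w v) y u + (dd (\<lambda>z. \<Gamma> z (jac y v) (jac y w)) (\<phi> y) (jac y u)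
       + \<Gamma> (\<phi> y) (hess y v u) (jac y w) + \<Gamma> (\<phi> y) (jac y v) (hess y w u)))) (at y)"
    by (intro has_derivative_add smooth_on_has_derivative[OF smooth_hess assms]
      bilinear_field_has_derivative[OF open_V maps[OF assms] \<Gamma>_bil \<Gamma>_der[OF maps[OF assms]] jac_der[OF assms] hess_der[OF assms] hess_der[OF assms]])
  have 2: "((\<lambda>y. jac y (christoffel g y v w)) has_derivative
     (\<lambda>u. hess y (christoffel g y v w) u + jac y (dd (\<lambda>y. christoffel g y v w) y u))) (at y)"
    by (intro linear_field_has_derivative[OF open_U assms jac_lin hess_der[OF assms]]
      christoffel_differentiable[OF assms, THEN frechet_derivative_works[THEN iffD1]])
  have "((\<lambda>y. jac y (christoffel g y v w)) has_derivative
     (\<lambda>u. dd (\<lambda>y. hess y w v) y u + (dd (\<lambda>z. \<Gamma> z (jac y v) (jac y w)) (\<phi> y) (jac y u)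
       + \<Gamma> (\<phi> y) (hess y v u) (jac y w) + \<Gamma> (\<phi> y) (jac y v) (hess y w u)))) (at y)"
    by (rule has_derivative_transform_within_open[OF 1 open_U assms]) (simp add: christoffel_pullback)
  from fun_cong[OF has_derivative_unique[OF 2 this], of u] show ?thesis
    by (simp add: algebra_simps eq_diff_eq)
qed

text \<open>On antisymmetrizing \<open>connection_derivative\<close> in \<open>u\<close> and \<open>v\<close>, the third derivatives of \<open>\<phi>\<close> drop out by
symmetry. The terms with second derivatives cancel against those that \<open>christoffel_pullback\<close> contributes
through the products of Christoffel symbols.\<close>

lemma riemann_pullback:
  assumes "y \<in> U"
  shows "jac y (riemann g y u v w) = riemann G (\<phi> y) (jac y u) (jac y v) (jac y w)"
proof -
  have z: "\<phi> y \<in> V" using maps assms by blast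
  have dG: "dd (\<lambda>z. christoffel G z a b) (\<phi> y) = dd (\<lambda>z. \<Gamma> z a b) (\<phi> y)" for a b
  proof -
    have "((\<lambda>z. christoffel G z a b) has_derivative dd (\<lambda>z. \<Gamma> z a b) (\<phi> y)) (at (\<phi> y))"
      by (rule has_derivative_transform_within_open[OF \<Gamma>_der[OF z] open_V z]) (simp add: christoffel_model)
    then show ?thesis by (rule frechet_derivative_at[symmetric])
  qed
  show ?thesis
    unfolding riemann_def dG christoffel_model[OF z]
    using hess_sym[OF assms, of u v] dhess_sym[OF assms, of w u v]
    by (simp add: connection_derivative[OF assms] linear_add[OF jac_lin[OF assms]] linear_diff[OF jac_lin[OF assms]] christoffel_pullback[OF assms]
      bilinear_radd[OF \<Gamma>_bil[OF z]] algebra_simps)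
qed

end

section \<open>The projective metric in an affine chart\<close>

locale pq_model =
  fixes h :: "'e::euclidean_space \<Rightarrow> 'e \<Rightarrow> real" and I1 I2 I3 :: "'e \<Rightarrow> 'e"
  assumes hermitian: "pq_hermitian_space h I1 I2 I3"
begin

lemma h_bil: "bilinear h" and h_sym: "h u v = h v u" and h_scalar: "scalar_product h"
  and triple: "pq_triple (-1) 1 1 I1 I2 I3"
  using hermitian unfolding pq_hermitian_space_def scalar_product_def by blast+

lemma skew: "h (I1 u) v = - h u (I1 v)" "h (I2 u) v = - h u (I2 v)" "h (I3 u) v = - h u (I3 v)"
  using hermitian unfolding pq_hermitian_space_def by blast+

text \<open>Skewness together with symmetry, as a rule that exchanges the arguments. Instantiated with chosen pairs of
vectors it orders the arguments of \<open>h\<close>, so that identities between curvature expressions become polynomial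
identities in independent scalars.\<close>

lemma skew': "h u (I1 v) = - h v (I1 u)" "h u (I2 v) = - h v (I2 u)" "h u (I3 v) = - h v (I3 u)"
  using skew h_sym by metis+

lemma lin: "linear I1" "linear I2" "linear I3"
  using pq_tripleD(1-3)[OF triple] by blast+

lemma I_products:
  "I1 (I1 v) = - v" "I2 (I2 v) = v" "I3 (I3 v) = v" "I1 (I2 v) = I3 v" "I2 (I1 v) = - I3 v"
  "I1 (I3 v) = - I2 v" "I3 (I1 v) = I2 v" "I3 (I2 v) = I1 v" "I2 (I3 v) = - I1 v"
proof -
  note D = pq_tripleD[OF triple]
  show "I1 (I1 v) = - v" "I2 (I2 v) = v" "I3 (I3 v) = v" "I1 (I2 v) = I3 v" "I2 (I1 v) = - I3 v"
    using D(7-11)[of v] by simp_all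
  show 13: "I1 (I3 v) = - I2 v" using D(10)[of v, symmetric] D(7)[of "I2 v"] by simp
  show "I3 (I1 v) = I2 v" using D(13)[of v] 13 by simp
  show 32: "I3 (I2 v) = I1 v" using D(10)[of "I2 v", symmetric] D(8)[of v] by simp
  show "I2 (I3 v) = - I1 v" using D(12)[of v] 32 by simp
qed

lemmas h_lin = bilinear_ladd[OF h_bil] bilinear_radd[OF h_bil] bilinear_lsub[OF h_bil] bilinear_rsub[OF h_bil]
  bilinear_lmul[OF h_bil] bilinear_rmul[OF h_bil] bilinear_lneg[OF h_bil] bilinear_rneg[OF h_bil]

lemmas I_lin = linear_add[OF lin(1)] linear_add[OF lin(2)] linear_add[OF lin(3)]
  linear_diff[OF lin(1)] linear_diff[OF lin(2)] linear_diff[OF lin(3)]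
  linear_neg[OF lin(1)] linear_neg[OF lin(2)] linear_neg[OF lin(3)]
  linear_cmul[OF lin(1)] linear_cmul[OF lin(2)] linear_cmul[OF lin(3)]

text \<open>With para-quaternionic scalars acting from the right and \<open>\<langle>x, v\<rangle>\<close> denoting the product whose real part is
\<open>h\<close>, this is \<open>u\<langle>x, v\<rangle> + v\<langle>x, u\<rangle>\<close>. The signs are those of \<open>h (I\<^sub>\<alpha> u) (I\<^sub>\<alpha> u) / h u u\<close>.\<close>

definition qprod :: "'e \<Rightarrow> 'e \<Rightarrow> 'e \<Rightarrow> 'e" where
  "qprod x u v = (h v x *\<^sub>R u + h u x *\<^sub>R v) + (h v (I1 x) *\<^sub>R I1 u + h u (I1 x) *\<^sub>R I1 v)
     - (h v (I2 x) *\<^sub>R I2 u + h u (I2 x) *\<^sub>R I2 v) - (h v (I3 x) *\<^sub>R I3 u + h u (I3 x) *\<^sub>R I3 v)"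

text \<open>The para-quaternionic counterpart of the Levi-Civita connection of the Fubini-Study metric in an affine
chart.\<close>

definition \<Gamma> :: "'e \<Rightarrow> 'e \<Rightarrow> 'e \<Rightarrow> 'e" where
  "\<Gamma> x u v = - inverse (1 + h x x) *\<^sub>R qprod x u v"

text \<open>The real part of \<open>\<langle>u, x\<rangle>\<langle>x, v\<rangle>\<close>, that is, \<open>h x x\<close> times the product of the components of \<open>u\<close> and \<open>v\<close>
along the para-quaternionic line of \<open>x\<close> if \<open>h x x\<close> is nonzero.\<close>

definition line_form :: "'e \<Rightarrow> 'e \<Rightarrow> 'e \<Rightarrow> real" where
  "line_form x u v = h u x * h v x + h u (I1 x) * h v (I1 x) - h u (I2 x) * h v (I2 x) - h u (I3 x) * h v (I3 x)"

lemma metric_alt: "projective_metric k h I1 I2 I3 x u v =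
    k * (h u v * inverse (1 + h x x) - line_form x u v * (inverse (1 + h x x))\<^sup>2)"
  by (simp add: projective_metric_def line_form_def divide_inverse power_inverse)

lemma qprod_lin: "qprod (x + y) u v = qprod x u v + qprod y u v" "qprod (r *\<^sub>R x) u v = r *\<^sub>R qprod x u v"
  "qprod x (u + u') v = qprod x u v + qprod x u' v" "qprod x (r *\<^sub>R u) v = r *\<^sub>R qprod x u v"
  "qprod x u (v + v') = qprod x u v + qprod x u v'" "qprod x u (r *\<^sub>R v) = r *\<^sub>R qprod x u v"
  by (simp_all add: qprod_def h_lin I_lin algebra_simps)

lemma qprod_neg: "qprod x u (- v) = - qprod x u v"
  using qprod_lin(6)[of x u "-1" v] by simp

lemma \<Gamma>_bil: "bilinear (\<Gamma> x)"
  unfolding bilinear_def \<Gamma>_def by (auto intro!: linearI simp: qprod_lin algebra_simps)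

lemma h_bounded_bilinear: "bounded_bilinear h"
  using h_bil by (simp add: bilinear_conv_bounded_bilinear)

lemma h_der:
  assumes "linear (L :: 'e \<Rightarrow> 'e)"
  shows "((\<lambda>y. h u (L y)) has_derivative (\<lambda>z. h u (L z))) (at x)"
proof (rule linear_imp_has_derivative)
  show "linear (\<lambda>y. h u (L y))"
    using linear_compose[OF assms, of "h u"] h_bil unfolding bilinear_def o_def by blast
qed

lemma reciprocal_der:
  assumes "1 + h x x \<noteq> 0"
  shows "((\<lambda>y. inverse (1 + h y y)) has_derivative (\<lambda>z. - 2 * h x z * (inverse (1 + h x x))\<^sup>2)) (at x)"
proof -
  have "((\<lambda>y. 1 + h y y) has_derivative (\<lambda>z. 0 + (h x z + h z x))) (at x)"
    by (intro has_derivative_add has_derivative_const bounded_bilinear.FDERIV[OF h_bounded_bilinear] has_derivative_ident)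
  from has_derivative_inverse'[THEN has_derivative_compose[OF this], OF assms]
  show ?thesis by (rule has_derivative_eq_rhs) (auto simp: h_sym power2_eq_square algebra_simps)
qed

lemma metric_der:
  assumes "1 + h x x \<noteq> 0"
  shows "((\<lambda>y. projective_metric k h I1 I2 I3 y u v) has_derivative (\<lambda>z.
     k * (h u v * (- 2 * h x z * (inverse (1 + h x x))\<^sup>2)
        - (h u x * h v z + h u z * h v x
           + (h u (I1 x) * h v (I1 z) + h u (I1 z) * h v (I1 x))
           - (h u (I2 x) * h v (I2 z) + h u (I2 z) * h v (I2 x))
           - (h u (I3 x) * h v (I3 z) + h u (I3 z) * h v (I3 x))) * (inverse (1 + h x x))\<^sup>2
        + 4 * h x z * line_form x u v * (inverse (1 + h x x)) ^ 3))) (at x)"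
proof -
  let ?r = "inverse (1 + h x x)"
  have sq: "((\<lambda>y. h u (L y) * h v (L y)) has_derivative (\<lambda>z. h u (L x) * h v (L z) + h u (L z) * h v (L x))) (at x)"
    if "linear L" for L
    by (rule has_derivative_mult[OF h_der[OF that] h_der[OF that]])
  note line_form' = has_derivative_diff[OF has_derivative_diff[OF has_derivative_add[OF sq[OF linear_ident]
    sq[OF lin(1)]] sq[OF lin(2)]] sq[OF lin(3)]]
  note r' = has_derivative_mult[OF reciprocal_der[OF assms] reciprocal_der[OF assms]]
  note D = has_derivative_mult_right[OF has_derivative_diff[OF
    has_derivative_mult_right[OF reciprocal_der[OF assms], of "h u v"] has_derivative_mult[OF line_form' r']], of k]
  show ?thesis
    unfolding metric_alt line_form_def power2_eq_square
    by (rule has_derivative_eq_rhs[OF D[unfolded power2_eq_square]])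
       (simp add: power3_eq_cube algebra_simps fun_eq_iff)
qed

text \<open>After \<open>h\<close> is brought into normal form, both sides are polynomials in \<open>r = 1 / (1 + h x x)\<close> and the scalars
\<open>h u (I\<^sub>\<alpha> w)\<close>, \<open>h u (I\<^sub>\<alpha> x)\<close> and the like. As \<open>h x x\<close> does not occur, the identity holds with \<open>r\<close> as an
independent variable.\<close>

lemma koszul:
  assumes "1 + h x x \<noteq> 0"
  shows "2 * projective_metric k h I1 I2 I3 x (\<Gamma> x u v) w =
     dd (\<lambda>y. projective_metric k h I1 I2 I3 y v w) x u + dd (\<lambda>y. projective_metric k h I1 I2 I3 y u w) x v
      - dd (\<lambda>y. projective_metric k h I1 I2 I3 y u v) x w"
proof -
  note dd = frechet_derivative_at[OF metric_der[OF assms], symmetric]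
  define r where "r = inverse (1 + h x x)"
  have eq: "k * a = k * b" if "a = b" for a b :: real using that by simp
  show ?thesis
    unfolding dd
    unfolding metric_alt \<Gamma>_def r_def[symmetric]
    by (simp add: qprod_def line_form_def h_lin I_lin skew I_products
       h_sym[of v u] h_sym[of w u] h_sym[of w v] h_sym[of x u] h_sym[of x v] h_sym[of x w]
       skew'[of v u] skew'[of w u] skew'[of w v] skew'[of x u] skew'[of x v] skew'[of x w])
       algebra
qed

lemma \<Gamma>_der:
  assumes "1 + h x x \<noteq> 0"
  shows "((\<lambda>y. \<Gamma> y v w) has_derivative (\<lambda>u. (2 * h x u * (inverse (1 + h x x))\<^sup>2) *\<^sub>R qprod x v w
     - inverse (1 + h x x) *\<^sub>R qprod u v w)) (at x)"
proof -
  have "linear (\<lambda>y. qprod y v w)" by (intro linearI) (simp_all add: qprod_lin)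
  then have "((\<lambda>y. qprod y v w) has_derivative (\<lambda>u. qprod u v w)) (at x)"
    by (rule linear_imp_has_derivative)
  then have "((\<lambda>y. - inverse (1 + h y y) *\<^sub>R qprod y v w) has_derivative (\<lambda>u.
     (- inverse (1 + h x x)) *\<^sub>R qprod u v w + (- (- 2 * h x u * (inverse (1 + h x x))\<^sup>2)) *\<^sub>R qprod x v w)) (at x)"
    by (intro has_derivative_scaleR has_derivative_minus reciprocal_der[OF assms])
  then show ?thesis unfolding \<Gamma>_def by (rule has_derivative_eq_rhs) auto
qed

text \<open>This identity and the next compare the coefficients of \<open>r\<close> and of \<open>r\<^sup>2\<close> in the curvature of \<open>\<Gamma>\<close> with those
of \<open>pq_curvature\<close>, which is linear in its bilinear form, for the form \<open>r h - r\<^sup>2 line_form\<close>. The scalar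
product with an arbitrary \<open>z\<close> reduces them to identities between polynomials.\<close>

lemma linear_curvature_identity:
  "qprod v u w - qprod u v w = 4 *\<^sub>R pq_curvature (-1) 1 1 h I1 I2 I3 u v w"
proof (rule scalar_product_eqI[OF h_scalar])
  fix z
  show "h (qprod v u w - qprod u v w) z = h (4 *\<^sub>R pq_curvature (-1) 1 1 h I1 I2 I3 u v w) z"
    by (simp add: qprod_def pq_curvature_def wedge_def h_lin I_lin skew I_products
       h_sym[of v u] h_sym[of w u] h_sym[of w v] h_sym[of z u] h_sym[of z v] h_sym[of z w]
       skew'[of v u] skew'[of w u] skew'[of w v] skew'[of z u] skew'[of z v] skew'[of z w] algebra_simps)
qed

lemma quadratic_curvature_identity:
  "(2 * h x u) *\<^sub>R qprod x v w - (2 * h x v) *\<^sub>R qprod x u w + qprod x u (qprod x v w) - qprod x v (qprod x u w) =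
     - 4 *\<^sub>R pq_curvature (-1) 1 1 (line_form x) I1 I2 I3 u v w"
proof (rule scalar_product_eqI[OF h_scalar])
  fix z
  show "h ((2 * h x u) *\<^sub>R qprod x v w - (2 * h x v) *\<^sub>R qprod x u w + qprod x u (qprod x v w) - qprod x v (qprod x u w)) z =
     h (- 4 *\<^sub>R pq_curvature (-1) 1 1 (line_form x) I1 I2 I3 u v w) z"
    by (simp add: qprod_def line_form_def pq_curvature_def wedge_def h_lin I_lin skew I_products
       h_sym[of v u] h_sym[of w u] h_sym[of w v] h_sym[of z u] h_sym[of z v] h_sym[of z w]
       h_sym[of x u] h_sym[of x v] h_sym[of x w] skew'[of x u] skew'[of x v] skew'[of x w]
       skew'[of v u] skew'[of w u] skew'[of w v] skew'[of z u] skew'[of z v] skew'[of z w] algebra_simps)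
qed

lemma local_metric:
  assumes S: "open S" "x \<in> S"
    and g: "\<And>y. y \<in> S \<Longrightarrow> 1 + h y y \<noteq> 0 \<and> g y = projective_metric k h I1 I2 I3 y"
  shows "(\<lambda>y. g y u v) differentiable (at x)"
    and "2 * g x (\<Gamma> x u v) w = dd (\<lambda>y. g y v w) x u + dd (\<lambda>y. g y u w) x v - dd (\<lambda>y. g y u v) x w"
proof -
  have x: "1 + h x x \<noteq> 0" "g x = projective_metric k h I1 I2 I3 x" using g[OF S(2)] by auto
  have D: "((\<lambda>y. g y u v) has_derivative dd (\<lambda>y. projective_metric k h I1 I2 I3 y u v) x) (at x)" for u v
    unfolding frechet_derivative_at[OF metric_der[OF x(1)], symmetric]
    by (rule has_derivative_transform_within_open[OF metric_der[OF x(1)] S]) (simp add: g)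
  then show "(\<lambda>y. g y u v) differentiable (at x)" unfolding differentiable_def by blast
  have dd: "dd (\<lambda>y. g y u v) x = dd (\<lambda>y. projective_metric k h I1 I2 I3 y u v) x" for u v
    by (rule frechet_derivative_at[OF D, symmetric])
  show "2 * g x (\<Gamma> x u v) w = dd (\<lambda>y. g y v w) x u + dd (\<lambda>y. g y u w) x v - dd (\<lambda>y. g y u v) x w"
    unfolding dd x(2) by (rule koszul[OF x(1)])
qed

lemma riemann_projective:
  assumes S: "open S" "x \<in> S"
    and g: "\<And>y. y \<in> S \<Longrightarrow> 1 + h y y \<noteq> 0 \<and> g y = projective_metric k h I1 I2 I3 y"
    and sp: "\<And>y. y \<in> S \<Longrightarrow> scalar_product (g y)" and k: "k \<noteq> 0"
  shows "riemann g x u v w = (4 / k) *\<^sub>R pq_curvature (-1) 1 1 (g x) I1 I2 I3 u v w"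
proof -
  define r where "r = inverse (1 + h x x)"
  have x: "1 + h x x \<noteq> 0" using g S by blast
  have chr: "christoffel g y a b = \<Gamma> y a b" if "y \<in> S" for y a b
    by (rule christoffel_eqI[where g = g and x = y, OF sp[OF that]],
        rule local_metric(2)[where g = g and k = k, OF S(1) that], erule g)
  have D: "dd (\<lambda>y. christoffel g y b c) x a = (2 * h x a * r\<^sup>2) *\<^sub>R qprod x b c - r *\<^sub>R qprod a b c" for a b c
  proof -
    have "((\<lambda>y. christoffel g y b c) has_derivative (\<lambda>a. (2 * h x a * r\<^sup>2) *\<^sub>R qprod x b c - r *\<^sub>R qprod a b c)) (at x)"
      unfolding r_def by (rule has_derivative_transform_within_open[OF \<Gamma>_der[OF x] S]) (simp add: chr)
    then show ?thesis by (rule fun_cong[OF frechet_derivative_at[symmetric]])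
  qed
  have "riemann g x u v w = r *\<^sub>R (qprod v u w - qprod u v w)
     + r\<^sup>2 *\<^sub>R ((2 * h x u) *\<^sub>R qprod x v w - (2 * h x v) *\<^sub>R qprod x u w + qprod x u (qprod x v w) - qprod x v (qprod x u w))"
    unfolding riemann_def D chr[OF S(2)] \<Gamma>_def r_def[symmetric]
    by (simp add: qprod_lin qprod_neg algebra_simps power2_eq_square)
  also have "\<dots> = 4 *\<^sub>R (r *\<^sub>R pq_curvature (-1) 1 1 h I1 I2 I3 u v w - r\<^sup>2 *\<^sub>R pq_curvature (-1) 1 1 (line_form x) I1 I2 I3 u v w)"
    unfolding linear_curvature_identity quadratic_curvature_identity by (simp add: scaleR_diff_right mult.commute)
  also have "\<dots> = (4 / k) *\<^sub>R pq_curvature (-1) 1 1 (g x) I1 I2 I3 u v w"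
  proof -
    have gx: "g x a b = k * (h a b * r - line_form x a b * r\<^sup>2)" for a b
      using g[OF S(2)] metric_alt unfolding r_def by simp
    have "pq_curvature (-1) 1 1 (g x) I1 I2 I3 u v w =
      k *\<^sub>R (r *\<^sub>R pq_curvature (-1) 1 1 h I1 I2 I3 u v w - r\<^sup>2 *\<^sub>R pq_curvature (-1) 1 1 (line_form x) I1 I2 I3 u v w)"
      unfolding pq_curvature_def wedge_def gx by (simp add: algebra_simps)
    then show ?thesis using k by simp
  qed
  finally show ?thesis .
qed

end

text \<open>This is what identifies the scale of the model metric with the prescribed reduced scalar curvature.\<close>

lemma reduced_scalar_curvature_pq:
  fixes g :: "'e::euclidean_space \<Rightarrow> 'e \<Rightarrow> 'e \<Rightarrow> real"
  assumes n: "DIM('e) = 4 * n" and g: "scalar_product (g x)" and J: "pq_triple e1 e2 e3 J1 J2 J3"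
    and sk: "\<And>u v. g x (J1 u) v = - g x u (J1 v)" "\<And>u v. g x (J2 u) v = - g x u (J2 v)"
      "\<And>u v. g x (J3 u) v = - g x u (J3 v)"
    and R: "\<And>u v w. riemann g x u v w = \<kappa> *\<^sub>R pq_curvature e1 e2 e3 (g x) J1 J2 J3 u v w"
  shows "reduced_scalar_curvature n g x = \<kappa>"
proof -
  have n0: "n > 0" using n DIM_positive[where 'a = 'e] by simp
  have "ricci g x u v = \<kappa> * (real n + 2) * g x u v" for u v
    unfolding ricci_def R using trace_pq_curvature[OF g J sk, of u v] n
    by (simp add: trace_on_scale)
  then have ric: "(THE w. \<forall>v. g x w v = ricci g x u v) = (\<kappa> * (real n + 2)) *\<^sub>R u" for u
    using g bilinear_lmul[of "g x"]
    by (intro the_equality scalar_product_eqI[OF g]) (auto simp: scalar_product_def)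
  have "scalar_curvature g x = \<kappa> * (real n + 2) * (4 * real n)"
    unfolding scalar_curvature_def ric using n
    by (simp add: trace_on_scale trace_on_id)
  moreover have "real n * (real n + 2) \<noteq> 0" using n0 by simp
  ultimately show ?thesis unfolding reduced_scalar_curvature_def by (simp add: field_simps)
qed

section \<open>Space forms and totally complex submanifolds\<close>

lemma chart_inv_left:
  assumes "is_chart c" "p \<in> fst c"
  shows "chart_inv c (snd c p) = p"
proof -
  have "inj_on (snd c) (fst c)"
    using assms(1) unfolding is_chart_def homeomorphism_def by (metis inj_on_inverseI)
  then show ?thesis using assms(2) unfolding chart_inv_def by simp
qed

lemma chart_open_image:
  assumes "is_chart c" "open W"
  shows "open (snd c ` (fst c \<inter> W))"
proof -
  obtain \<psi> where hom: "homeomorphism (fst c) (chart_image c) (snd c) \<psi>" and op: "open (chart_image c)"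
    using assms(1) unfolding is_chart_def by blast
  have "snd c ` (fst c \<inter> W) = chart_image c \<inter> \<psi> -` W"
    using hom unfolding homeomorphism_def chart_image_def by auto
  then show ?thesis
    using continuous_open_preimage[OF _ op assms(2), of \<psi>] hom unfolding homeomorphism_def by simp
qed

lemma pullback_chart_change:
  assumes A: "smooth_structure A" and G: "pseudo_riemannian A G"
    and c: "c \<in> A" and d: "d \<in> A"
    and \<Gamma>: "\<And>z u v. z \<in> chart_image d \<Longrightarrow> (\<lambda>z. \<Gamma> z u v) differentiable (at z)"
      "\<And>z. z \<in> chart_image d \<Longrightarrow> bilinear (\<Gamma> z)"
    and koszul: "\<And>z u v w. z \<in> chart_image d \<Longrightarrow> 2 * G d z (\<Gamma> z u v) w =
       dd (\<lambda>y. G d y v w) z u + dd (\<lambda>y. G d y u w) z v - dd (\<lambda>y. G d y u v) z w"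
  shows "connection_pullback (snd c ` (fst c \<inter> fst d)) (snd d ` (fst c \<inter> fst d))
    (transition c d) (transition d c) (G c) (G d) \<Gamma>"
proof
  have chc: "is_chart c" and chd: "is_chart d" using A c d unfolding smooth_structure_def by blast+
  have opn: "open (fst c)" "open (fst d)" using chc chd unfolding is_chart_def by blast+
  show "open (snd c ` (fst c \<inter> fst d))" by (rule chart_open_image[OF chc opn(2)])
  show "open (snd d ` (fst c \<inter> fst d))" using chart_open_image[OF chd opn(1)] by (simp add: Int_commute)
  have tr: "transition c d (snd c q) = snd d q" "transition d c (snd d q) = snd c q"
    if "q \<in> fst c \<inter> fst d" for q
    using that by (auto simp: transition_def local_rep_def chart_inv_left chc chd)
  have imc: "snd c ` (fst c \<inter> fst d) \<subseteq> chart_image c" and imd: "snd d ` (fst c \<inter> fst d) \<subseteq> chart_image d"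
    unfolding chart_image_def by auto
  show "transition c d y \<in> snd d ` (fst c \<inter> fst d)" if "y \<in> snd c ` (fst c \<inter> fst d)" for y
    using that by (auto simp: tr)
  show "transition d c (transition c d y) = y" if "y \<in> snd c ` (fst c \<inter> fst d)" for y
    using that by (auto simp: tr)
  show "transition c d (transition d c z) = z" if "z \<in> snd d ` (fst c \<inter> fst d)" for z
    using that by (auto simp: tr)
  show "smooth_on (snd c ` (fst c \<inter> fst d)) (transition c d)" "smooth_on (snd d ` (fst c \<inter> fst d)) (transition d c)"
    using A c d unfolding smooth_structure_def compatible_def by blast+
  show "G c y u v = G d (transition c d y) (frechet_derivative (transition c d) (at y) u)
      (frechet_derivative (transition c d) (at y) v)" if "y \<in> snd c ` (fst c \<inter> fst d)" for y u v
  proof -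
    from that obtain q where q: "y = snd c q" "q \<in> fst c \<inter> fst d" by (rule imageE)
    have "G c (snd c q) u v = G d (snd d q) (change c d q u) (change c d q v)"
      using G c d q(2) unfolding pseudo_riemannian_def by blast
    then show ?thesis using q(1) tr(1)[OF q(2)] by (simp add: change_def)
  qed
  show "scalar_product (G c y)" if "y \<in> snd c ` (fst c \<inter> fst d)" for y
    using G c that imc unfolding pseudo_riemannian_def by blast
  show "scalar_product (G d z)" if "z \<in> snd d ` (fst c \<inter> fst d)" for z
    using G d that imd unfolding pseudo_riemannian_def by blast
  show "(\<lambda>z. G d z u v) differentiable (at z)" if "z \<in> snd d ` (fst c \<inter> fst d)" for z u v
  proof (rule smooth_on_differentiable[of "chart_image d"])
    show "smooth_on (chart_image d) (\<lambda>z. G d z u v)" using G d unfolding pseudo_riemannian_def by blast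
    show "z \<in> chart_image d" using that imd by blast
  qed
  show "(\<lambda>z. \<Gamma> z u v) differentiable (at z)" if "z \<in> snd d ` (fst c \<inter> fst d)" for z u v
    using \<Gamma>(1) that imd by blast
  show "bilinear (\<Gamma> z)" if "z \<in> snd d ` (fst c \<inter> fst d)" for z using \<Gamma>(2) that imd by blast
  show "2 * G d z (\<Gamma> z u v) w =
       dd (\<lambda>y. G d y v w) z u + dd (\<lambda>y. G d y u w) z v - dd (\<lambda>y. G d y u v) z w"
    if "z \<in> snd d ` (fst c \<inter> fst d)" for z u v w
    by (rule koszul) (use that imd in blast)
qed

lemma end_span3_self: "{J1, J2, J3} \<subseteq> end_span3 J1 J2 J3"
proof -
  have "J1 = (\<lambda>v. 1 *\<^sub>R J1 v + 0 *\<^sub>R J2 v + 0 *\<^sub>R J3 v)" "J2 = (\<lambda>v. 0 *\<^sub>R J1 v + 1 *\<^sub>R J2 v + 0 *\<^sub>R J3 v)"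
     "J3 = (\<lambda>v. 0 *\<^sub>R J1 v + 0 *\<^sub>R J2 v + 1 *\<^sub>R J3 v)" by auto
  then show ?thesis unfolding end_span3_def by blast
qed

text \<open>Naturality of \<open>R\<^sub>0\<close>: an intertwining isometry carries one curvature tensor to the other.\<close>

lemma pq_curvature_conj:
  assumes a: "linear a" and K: "\<And>v. a (K1 v) = I1 (a v)" "\<And>v. a (K2 v) = I2 (a v)" "\<And>v. a (K3 v) = I3 (a v)"
    and g: "\<And>u v. g u v = g' (a u) (a v)"
  shows "a (pq_curvature e1 e2 e3 g K1 K2 K3 u v w) = pq_curvature e1 e2 e3 g' I1 I2 I3 (a u) (a v) (a w)"
  by (simp add: pq_curvature_def wedge_def linear_add[OF a] linear_diff[OF a] linear_cmul[OF a] K g)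

text \<open>Near \<open>q\<close> there is a chart \<open>d\<close> in which the manifold is the model, so that the curvature tensor is known
there. It is carried to the chart \<open>c\<close> by the Jacobian \<open>a\<close> of the change of charts; conjugation by \<open>a\<close> turns
the constant triple of the model into another basis \<open>K I1\<close>, \<open>K I2\<close>, \<open>K I3\<close> of \<open>Q\<close> at \<open>q\<close>, which is
then exchanged for the given one.\<close>

lemma space_form_curvature:
  fixes A :: "('m::{t2_space, second_countable_topology}, 'e::euclidean_space) chart set"
  assumes form: "nonflat_pq_space_form n \<nu> A G Q" and c: "c \<in> A" and q: "q \<in> fst c"
    and J: "pq_triple e1 e2 e3 J1 J2 J3" and QJ: "Q c (snd c q) = end_span3 J1 J2 J3"
  shows "riemann (G c) (snd c q) u v w = \<nu> *\<^sub>R pq_curvature e1 e2 e3 (G c (snd c q)) J1 J2 J3 u v w"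
proof -
  obtain k h I1 I2 I3 where k: "k \<noteq> 0" and herm: "pq_hermitian_space h I1 I2 I3"
    and model: "\<forall>p. \<exists>d\<in>A. p \<in> fst d \<and> (\<forall>x\<in>chart_image d. 1 + h x x \<noteq> 0 \<and>
       G d x = projective_metric k h I1 I2 I3 x \<and> Q d x = end_span3 I1 I2 I3)"
    using form unfolding nonflat_pq_space_form_def by blast
  obtain d where d: "d \<in> A" "q \<in> fst d" and
    Gd: "\<And>x. x \<in> chart_image d \<Longrightarrow> 1 + h x x \<noteq> 0 \<and> G d x = projective_metric k h I1 I2 I3 x"
    and Qd: "\<And>x. x \<in> chart_image d \<Longrightarrow> Q d x = end_span3 I1 I2 I3"
    using model[rule_format, of q] by blast
  have pqk: "para_quaternionic_kaehler n A G Q" and red: "\<And>x. x \<in> chart_image d \<Longrightarrow> reduced_scalar_curvature n (G d) x = \<nu>"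
    using form d(1) unfolding nonflat_pq_space_form_def by blast+
  have A: "smooth_structure A" and G: "pseudo_riemannian A G" and dim: "DIM('e) = 4 * n"
    and apq: "almost_para_quaternionic A Q"
    and skQ: "\<And>x K u v. x \<in> chart_image d \<Longrightarrow> K \<in> Q d x \<Longrightarrow> G d x (K u) v = - G d x u (K v)"
    using pqk d(1) unfolding para_quaternionic_kaehler_def by blast+
  have chd: "open (chart_image d)" using A d(1) unfolding smooth_structure_def is_chart_def by blast
  have chc: "is_chart c" using A c unfolding smooth_structure_def by blast
  have spd: "scalar_product (G d x)" if "x \<in> chart_image d" for x
    using G d(1) that unfolding pseudo_riemannian_def by blast
  interpret pq_model h I1 I2 I3 by unfold_locales (rule herm)
  define y where "y = snd c q"
  define z where "z = snd d q"
  have z: "z \<in> chart_image d" using d(2) unfolding z_def chart_image_def by blast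
  have diff: "(\<lambda>z. \<Gamma> z u v) differentiable (at x)" if "x \<in> chart_image d" for x u v
    using \<Gamma>_der Gd[OF that] unfolding differentiable_def by blast
  interpret cp: connection_pullback "snd c ` (fst c \<inter> fst d)" "snd d ` (fst c \<inter> fst d)" "transition c d"
    "transition d c" "G c" "G d" \<Gamma>
    by (rule pullback_chart_change[OF A G c d(1) diff \<Gamma>_bil local_metric(2)[where g = "G d" and k = k, OF chd _ Gd]])
  have y: "y \<in> snd c ` (fst c \<inter> fst d)" using q d(2) unfolding y_def by blast
  have yz: "transition c d y = z"
    using q by (simp add: y_def z_def transition_def local_rep_def chart_inv_left[OF chc])
  define a where "a = cp.jac y"
  define b where "b = frechet_derivative (transition d c) (at z)"
  have a: "linear a" unfolding a_def by (rule cp.jac_lin[OF y])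
  have ba: "b (a v) = v" and ab: "a (b v) = v" for v
    using cp.inverse_der[OF y, of v] unfolding a_def b_def yz by blast+
  have b: "linear b"
    unfolding b_def by (rule linear_frechet_derivative[OF smooth_on_differentiable[OF cp.smooth(2)]])
      (use q d(2) in \<open>auto simp: z_def\<close>)
  have change: "change c d q = a" unfolding change_def a_def cp.jac_def y_def ..
  have g: "G c y u v = G d z (a u) (a v)" for u v
    using cp.pull[OF y] unfolding yz a_def cp.jac_def by blast
  have mem: "{I1, I2, I3} \<subseteq> Q d z" unfolding Qd[OF z] by (rule end_span3_self)
  have \<nu>: "\<nu> = 4 / k"
  proof -
    have R: "riemann (G d) z u v w = (4 / k) *\<^sub>R pq_curvature (-1) 1 1 (G d z) I1 I2 I3 u v w" for u v w
      by (rule riemann_projective[OF chd z Gd spd k])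
    show ?thesis
      using reduced_scalar_curvature_pq[where g = "G d" and x = z, OF dim spd[OF z] triple _ _ _ R] red[OF z] skQ[OF z] mem
      by auto
  qed
  have QcD: "Q c y = {K. linear K \<and> (\<exists>L\<in>Q d z. \<forall>v. a (K v) = L (a v))}"
    using apq c d q unfolding almost_para_quaternionic_def y_def z_def change[symmetric] by blast
  \<comment> \<open>The basis of \<open>Q\<close> at \<open>q\<close> that the chart \<open>d\<close> sees as \<open>I1\<close>, \<open>I2\<close>, \<open>I3\<close>.\<close>
  define K where "K I v = b (I (a v))" for I v
  have aK: "a (K I v) = I (a v)" for I v unfolding K_def ab ..
  have linK: "linear (K I)" if "linear I" for I
    unfolding K_def using linear_compose[OF linear_compose[OF a that] b] by (simp add: o_def)
  have KQ: "{K I1, K I2, K I3} \<subseteq> end_span3 J1 J2 J3"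
    unfolding QJ[symmetric] y_def[symmetric] QcD using mem linK lin aK by blast
  have JK: "{J1, J2, J3} \<subseteq> end_span3 (K I1) (K I2) (K I3)"
  proof
    fix L assume "L \<in> {J1, J2, J3}"
    then have "L \<in> Q c y" using end_span3_self unfolding y_def QJ by blast
    then obtain L' where L': "L' \<in> end_span3 I1 I2 I3" "\<And>v. a (L v) = L' (a v)"
      unfolding QcD Qd[OF z] by blast
    obtain r s t where rst: "L' = (\<lambda>v. r *\<^sub>R I1 v + s *\<^sub>R I2 v + t *\<^sub>R I3 v)"
      using L'(1) unfolding end_span3_def by auto
    have "L v = r *\<^sub>R K I1 v + s *\<^sub>R K I2 v + t *\<^sub>R K I3 v" for v
    proof -
      have "L v = b (L' (a v))" using L'(2) ba by metis
      then show ?thesis unfolding rst K_def by (simp add: linear_add[OF b] linear_cmul[OF b])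
    qed
    then have "L = (\<lambda>v. r *\<^sub>R K I1 v + s *\<^sub>R K I2 v + t *\<^sub>R K I3 v)" by blast
    then show "L \<in> end_span3 (K I1) (K I2) (K I3)" unfolding end_span3_def by blast
  qed
  have tripleK: "pq_triple (-1) 1 1 (K I1) (K I2) (K I3)"
    unfolding pq_triple_def using linK lin
    by (simp add: K_def ab I_products linear_neg[OF b] linear_cmul[OF b] ba)
  have bilG: "bilinear (G c y)" using cp.sp(1)[OF y] unfolding scalar_product_def by blast
  have "riemann (G c) y u v w = b (riemann (G d) z (a u) (a v) (a w))"
    using cp.riemann_pullback[OF y, of u v w] ba unfolding yz a_def[symmetric] by metis
  also have "\<dots> = b (\<nu> *\<^sub>R pq_curvature (-1) 1 1 (G d z) I1 I2 I3 (a u) (a v) (a w))"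
    unfolding \<nu> by (subst riemann_projective[OF chd z Gd spd k]) simp_all
  also have "\<dots> = b (\<nu> *\<^sub>R a (pq_curvature (-1) 1 1 (G c y) (K I1) (K I2) (K I3) u v w))"
    by (subst pq_curvature_conj[where a = a and g = "G c y" and g' = "G d z" and ?K1.0 = "K I1" and ?K2.0 = "K I2"
          and ?K3.0 = "K I3" and ?I1.0 = I1 and ?I2.0 = I2 and ?I3.0 = I3, OF a aK aK aK])
       (simp_all add: g)
  also have "\<dots> = \<nu> *\<^sub>R pq_curvature (-1) 1 1 (G c y) (K I1) (K I2) (K I3) u v w"
    by (simp add: linear_cmul[OF b] ba)
  also have "\<dots> = \<nu> *\<^sub>R pq_curvature e1 e2 e3 (G c y) J1 J2 J3 u v w"
    unfolding pq_curvature_basis_independent[OF tripleK J KQ JK bilG] ..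
  finally show ?thesis unfolding y_def .
qed

text \<open>The tangent space is defined as a union over all charts of the submanifold around \<open>p\<close>. By the chain rule
for the changes of charts, all its members coincide, so it is the injective image of a single coordinate
space.\<close>

lemma tangent_space_range:
  fixes B :: "('k::{t2_space, second_countable_topology}, 'd::euclidean_space) chart set"
  assumes B: "smooth_structure B" and f: "immersion B A f" and A: "\<forall>c\<in>A. is_chart c" "c \<in> A" "f p \<in> fst c"
  shows "subspace (tangent_space B f c p) \<and> dim (tangent_space B f c p) = DIM('d)"
proof -
  obtain b where b: "b \<in> B" "p \<in> fst b" using B unfolding smooth_structure_def by blast
  have chB: "is_chart b" if "b \<in> B" for b using B that unfolding smooth_structure_def by blast
  define D where "D b = frechet_derivative (local_rep b f c) (at (snd b p))" for b :: "('k, 'd) chart"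
  have der: "(local_rep b f c has_derivative D b) (at (snd b p))" if "b \<in> B" "p \<in> fst b" for b
    unfolding D_def
  proof (rule smooth_on_has_derivative)
    show "smooth_on (snd b ` (fst b \<inter> f -` fst c)) (local_rep b f c)"
      using f that A(2) unfolding immersion_def by blast
  qed (use that A in blast)
  have sub: "range (D b') \<subseteq> range (D b)" if b: "b \<in> B" "p \<in> fst b" and b': "b' \<in> B" "p \<in> fst b'" for b b'
  proof -
    let ?U = "snd b' ` (fst b' \<inter> fst b)" and ?t = "transition b' b"
    have U: "open ?U" using chart_open_image[OF chB[OF b'(1)]] chB[OF b(1)] unfolding is_chart_def by blast
    have p: "snd b' p \<in> ?U" using b b' by blast
    have tp: "?t (snd b' p) = snd b p"
      using b' chB by (simp add: transition_def local_rep_def chart_inv_left)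
    have t: "(?t has_derivative frechet_derivative ?t (at (snd b' p))) (at (snd b' p))"
      by (rule smooth_on_has_derivative[OF _ p]) (use B b b' in \<open>auto simp: smooth_structure_def compatible_def\<close>)
    have "((\<lambda>y. local_rep b f c (?t y)) has_derivative (\<lambda>v. D b (frechet_derivative ?t (at (snd b' p)) v))) (at (snd b' p))"
      by (rule has_derivative_compose[OF t]) (simp add: tp der b)
    then have "(local_rep b' f c has_derivative (\<lambda>v. D b (frechet_derivative ?t (at (snd b' p)) v))) (at (snd b' p))"
    proof (rule has_derivative_transform_within_open[OF _ U p])
      fix y assume "y \<in> ?U"
      then obtain q where q: "q \<in> fst b'" "q \<in> fst b" "y = snd b' q" by blast
      then show "local_rep b f c (?t y) = local_rep b' f c y"
        using chB b b' by (simp add: transition_def local_rep_def chart_inv_left)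
    qed
    then have "D b' = (\<lambda>v. D b (frechet_derivative ?t (at (snd b' p)) v))"
      using has_derivative_unique[OF der[OF b']] by blast
    then show ?thesis by auto
  qed
  have T: "tangent_space B f c p = range (D b)"
    unfolding tangent_space_def D_def[symmetric] using b sub[OF b] by blast
  have lin: "linear (D b)" using der[OF b] has_derivative_linear by blast
  have inj: "inj (D b)" using f b A unfolding immersion_def D_def by blast
  show ?thesis
    unfolding T using linear_subspace_image[OF lin subspace_UNIV] dim_image_eq[OF lin, of UNIV] inj by simp
qed

theorem proposition5p13:
  fixes n :: nat and \<epsilon> \<nu> :: real
    and A :: "('m::{t2_space, second_countable_topology}, 'e::euclidean_space) chart set"
    and G :: "('m, 'e) metric_field"
    and Q :: "('m, 'e) end_bundle"
    and B :: "('k::{t2_space, second_countable_topology}, 'd::euclidean_space) chart set"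
    and f :: "'k \<Rightarrow> 'm"
    and J :: "'k \<Rightarrow> ('m, 'e) chart \<Rightarrow> 'e \<Rightarrow> 'e"
    and c :: "('m, 'e) chart" and p :: 'k
    and g :: "'e \<Rightarrow> 'e \<Rightarrow> real" and R :: "'e \<Rightarrow> 'e \<Rightarrow> 'e \<Rightarrow> 'e" and T N :: "'e set"
    and J1 J2 J3 :: "'e \<Rightarrow> 'e" and X Y :: 'e
  assumes "\<epsilon> \<in> {-1, 1}"
    and "nonflat_pq_space_form n \<nu> A G Q"
    and "totally_complex_submanifold n \<epsilon> B A G Q f J"
    and "c \<in> A" and "f p \<in> fst c"
  defines "g \<equiv> G c (snd c (f p))"
    and "R \<equiv> riemann (G c) (snd c (f p))"
    and "T \<equiv> tangent_space B f c p"
    and "N \<equiv> orth_complement g T"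
  assumes "adapted_basis \<epsilon> (Q c (snd c (f p))) (J p c) J1 J2 J3"
    and "X \<in> T" and "Y \<in> T"
  shows "(\<forall>Z\<in>T. tan_part g T (R X Y Z) = - (\<epsilon> * \<nu>) *\<^sub>R R_CP \<epsilon> g (J p c) X Y Z \<and>
            - (\<epsilon> * \<nu>) *\<^sub>R R_CP \<epsilon> g (J p c) X Y Z =
              (\<epsilon> * \<nu> / 4) *\<^sub>R (\<epsilon> *\<^sub>R wedge g X Y Z - wedge g (J1 X) (J1 Y) Z
                               + (2 * g (J1 X) Y) *\<^sub>R J1 Z)) \<and>
         trace_on T (\<lambda>Z. tan_part g T (R Z X Y)) = \<nu> / 2 * (real n + 1) * g X Y \<and>
         (\<forall>Z\<in>T. nor_part g T (R X Y Z) = 0) \<and>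
         (\<forall>Z\<in>N. tan_part g T (R X Y Z) = 0) \<and>
         (\<forall>Z\<in>N. nor_part g T (R X Y Z) =
            (\<nu> / 4) *\<^sub>R (- wedge g (J2 X) (J2 Y) Z + \<epsilon> *\<^sub>R wedge g (J3 X) (J3 Y) Z
                         + (2 * \<epsilon> * g (J1 X) Y) *\<^sub>R J1 Z))"
proof -
  have form: "para_quaternionic_kaehler n A G Q" using assms(2) unfolding nonflat_pq_space_form_def by blast
  then have A: "smooth_structure A" and G: "pseudo_riemannian A G"
    and skQ: "\<And>x K u v. x \<in> chart_image c \<Longrightarrow> K \<in> Q c x \<Longrightarrow> G c x (K u) v = - G c x u (K v)"
    using assms(4) unfolding para_quaternionic_kaehler_def by blast+
  have x: "snd c (f p) \<in> chart_image c" using assms(5) unfolding chart_image_def by blast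
  have J: "J p c = J1" "pq_triple \<epsilon> 1 (- \<epsilon>) J1 J2 J3" "Q c (snd c (f p)) = end_span3 J1 J2 J3"
    using assms(10) unfolding adapted_basis_def by auto
  have ah: "almost_hermitian_submanifold \<epsilon> B A G Q f J" and dimd: "DIM('d) = 2 * n"
    and J2: "\<And>X. X \<in> T \<Longrightarrow> J2 X \<in> orth_complement g T"
    using assms(3-5,10) unfolding totally_complex_submanifold_def T_def g_def by blast+
  have B: "smooth_structure B" "immersion B A f" and T: "nondegenerate_on g T" "J1 ` T = T"
    using ah assms(4,5) unfolding almost_hermitian_submanifold_def g_def T_def J(1)[symmetric] by blast+
  have chA: "\<forall>c\<in>A. is_chart c" using A unfolding smooth_structure_def by blast
  have sT: "subspace T" "dim T = 2 * n"
    using tangent_space_range[OF B chA assms(4,5)] dimd unfolding T_def by auto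
  have sp: "scalar_product g" using G assms(4) x unfolding pseudo_riemannian_def g_def by blast
  have sk: "g (J1 u) v = - g u (J1 v)" "g (J2 u) v = - g u (J2 v)" for u v
    using skQ[OF x] end_span3_self[of J1 J2 J3] unfolding J(3) g_def by auto
  have R: "R X Y Z = \<nu> *\<^sub>R pq_curvature \<epsilon> 1 (- \<epsilon>) g J1 J2 J3 X Y Z" for X Y Z
    unfolding R_def g_def by (rule space_form_curvature[OF assms(2,4,5) J(2,3)])
  show ?thesis
    unfolding J(1) N_def
    by (rule totally_complex_curvature[OF assms(1) sp J(2) sk sT(1) T(1) sT(2) T(2) J2 R assms(11,12)])
qed

end
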